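(* (i) $\mathrm{EST}+\mathrm{VP}$ proves the $\Delta_0$-Replacement scheme. (ii) $\mathrm{EST}+\mathrm{VP}+\Delta_0$-Replacement proves the full Replacement scheme. (iii) Consequently $\mathrm{EST}+\mathrm{VP}$ proves the full Replacement scheme.
   Context: All theories are in the language $\{\in\}$. EST is the theory with the axioms: Extensionality, Empty Set, Pairing, Union, Cartesian Product (for all sets $x,y$, $x\times y$ is a set), $\Delta_0$-Separation, and the Induction scheme along $\omega$: with $\mathrm{Ord}(x)$ meaning "$x$ is transitive and linearly ordered by $\in$ (trichotomy)", $\mathrm{Nat}(x)$ meaning $\mathrm{Ord}(x)$ and every $y\in x\cup\{x\}$ is $\emptyset$ or of the form $z\cup\{z\}$ with $z\in y$, and $\omega=\{x:\mathrm{Nat}(x)\}$ (a class), for each formula $\phi$ with $\phi(x)\to\mathrm{Nat}(x)$: $[\phi(\emptyset)\wedge(\forall x\in\omega)(\phi(x)\to\phi(x\cup\{x\}))]\to(\forall x\in\omega)\phi(x)$. $\Delta_0$-Replacement is Replacement restricted to $\Delta_0$ formulas $\phi(x,y)$ defining functional relations. For a formula $\phi(x)$, $X_\phi=\{x:\phi(x)\}$; "$X_\phi$ is a proper class" means $(\forall x)(\exists y)[(\phi(y)\wedge y\notin x)\vee(\neg\phi(y)\wedge y\in x)]$. For a set $A$, $L_A$ is the first-order language with equality, a unary predicate $\mathbf U$, a binary predicate $\mathbf R$ (either may be omitted) and a constant $\mathbf c_a$ for each $a\in A$ (coded as sets in the standard way). An $L_A$-structure is $\langle M,U,R,I\rangle$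 with $U\subseteq M$, $R\subseteq M\times M$, $I:A\to M$ a function interpreting $\mathbf c_a$ as $I(a)$; satisfaction and elementary embeddings (injective maps preserving all $L_A$-formulas) are defined as usual. VP is the scheme: for every formula $\phi(x)$ and every set $A$, if $X_\phi$ is a proper class of $L_A$-structures, then there are distinct $\mathcal M,\mathcal N\in X_\phi$ and an elementary embedding $f:\mathcal M\to\mathcal N$. *)

theory Defs
  imports Main
begin

section \<open>First-order logic in the language of set theory\<close>

text \<open>De Bruijn syntax: \<^term>\<open>i\<close> refers to the \<^term>\<open>i\<close>-th enclosing quantifier, or to a free variable.\<close>

datatype fm =
    FEq nat nat
  | FMem nat nat
  | FBot
  | FImp fm fm
  | FAll fm

abbreviation FNeg :: "fm \<Rightarrow> fm" where "FNeg p \<equiv> FImp p FBot"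
abbreviation FAnd :: "fm \<Rightarrow> fm \<Rightarrow> fm" where "FAnd p q \<equiv> FNeg (FImp p (FNeg q))"
abbreviation FOr :: "fm \<Rightarrow> fm \<Rightarrow> fm" where "FOr p q \<equiv> FImp (FNeg p) q"
abbreviation FIff :: "fm \<Rightarrow> fm \<Rightarrow> fm" where "FIff p q \<equiv> FAnd (FImp p q) (FImp q p)"
abbreviation FEx :: "fm \<Rightarrow> fm" where "FEx p \<equiv> FNeg (FAll (FNeg p))"

primrec ren :: "(nat \<Rightarrow> nat) \<Rightarrow> fm \<Rightarrow> fm" where
  "ren f (FEq i j) = FEq (f i) (f j)"
| "ren f (FMem i j) = FMem (f i) (f j)"
| "ren f FBot = FBot"
| "ren f (FImp p q) = FImp (ren f p) (ren f q)"
| "ren f (FAll p) = FAll (ren (case_nat 0 (\<lambda>i. Suc (f i))) p)"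

definition lift :: "fm \<Rightarrow> fm" where
  "lift = ren Suc"

text \<open>Instantiation of the outermost bound variable; variables are the only terms of the language.\<close>

definition inst :: "nat \<Rightarrow> fm \<Rightarrow> fm" where
  "inst x = ren (case_nat x (\<lambda>i. i))"

text \<open>All free variables of \<^term>\<open>p\<close> are below \<^term>\<open>fbound p\<close>.\<close>

primrec fbound :: "fm \<Rightarrow> nat" where
  "fbound (FEq i j) = max (Suc i) (Suc j)"
| "fbound (FMem i j) = max (Suc i) (Suc j)"
| "fbound FBot = 0"
| "fbound (FImp p q) = max (fbound p) (fbound q)"
| "fbound (FAll p) = fbound p - 1"

definition ucl :: "fm \<Rightarrow> fm" where
  "ucl p = (FAll ^^ fbound p) p"

text \<open>Classical natural deduction with equality.\<close>

inductive proves :: "fm set \<Rightarrow> fm \<Rightarrow> bool" (infix "\<turnstile>" 50) where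
  Assm: "p \<in> \<Gamma> \<Longrightarrow> \<Gamma> \<turnstile> p"
| ImpI: "insert p \<Gamma> \<turnstile> q \<Longrightarrow> \<Gamma> \<turnstile> FImp p q"
| ImpE: "\<Gamma> \<turnstile> FImp p q \<Longrightarrow> \<Gamma> \<turnstile> p \<Longrightarrow> \<Gamma> \<turnstile> q"
| Contr: "insert (FNeg p) \<Gamma> \<turnstile> FBot \<Longrightarrow> \<Gamma> \<turnstile> p"
| AllI: "lift ` \<Gamma> \<turnstile> p \<Longrightarrow> \<Gamma> \<turnstile> FAll p"
| AllE: "\<Gamma> \<turnstile> FAll p \<Longrightarrow> \<Gamma> \<turnstile> inst x p"
| EqI: "\<Gamma> \<turnstile> FEq x x"
| EqE: "\<Gamma> \<turnstile> FEq x y \<Longrightarrow> \<Gamma> \<turnstile> inst x p \<Longrightarrow> \<Gamma> \<turnstile> inst y p"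

inductive delta0 :: "fm \<Rightarrow> bool" where
  "delta0 (FEq i j)"
| "delta0 (FMem i j)"
| "delta0 FBot"
| "delta0 p \<Longrightarrow> delta0 q \<Longrightarrow> delta0 (FImp p q)"
| "delta0 p \<Longrightarrow> delta0 (FAll (FImp (FMem 0 (Suc j)) p))"
| "delta0 p \<Longrightarrow> delta0 (FEx (FAnd (FMem 0 (Suc j)) p))"


section \<open>Writing formulas with named bound variables\<close>

text \<open>
  Concrete formulas are written as functions of their quantifier depth. A variable is
  denoted by the depth at which it was bound (its level), which stays fixed under further
  quantifiers, so that HOL binders can be used for the object-level quantifiers; at depth
  \<^term>\<open>d\<close>, level \<^term>\<open>x\<close> is the de Bruijn index \<^term>\<open>d - Suc x\<close>.
\<close>

type_synonym frm = "nat \<Rightarrow> fm"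

definition mem :: "nat \<Rightarrow> nat \<Rightarrow> frm" (infix "\<^bold>\<in>" 50) where
  "(x \<^bold>\<in> y) = (\<lambda>d. FMem (d - Suc x) (d - Suc y))"

definition equ :: "nat \<Rightarrow> nat \<Rightarrow> frm" (infix "\<^bold>=" 50) where
  "(x \<^bold>= y) = (\<lambda>d. FEq (d - Suc x) (d - Suc y))"

definition neg :: "frm \<Rightarrow> frm" ("\<^bold>\<not> _" [40] 40) where
  "(\<^bold>\<not> P) = (\<lambda>d. FNeg (P d))"

definition con :: "frm \<Rightarrow> frm \<Rightarrow> frm" (infixr "\<^bold>\<and>" 35) where
  "(P \<^bold>\<and> Q) = (\<lambda>d. FAnd (P d) (Q d))"

definition dis :: "frm \<Rightarrow> frm \<Rightarrow> frm" (infixr "\<^bold>\<or>" 30) where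
  "(P \<^bold>\<or> Q) = (\<lambda>d. FOr (P d) (Q d))"

definition imp :: "frm \<Rightarrow> frm \<Rightarrow> frm" (infixr "\<^bold>\<longrightarrow>" 25) where
  "(P \<^bold>\<longrightarrow> Q) = (\<lambda>d. FImp (P d) (Q d))"

definition iff :: "frm \<Rightarrow> frm \<Rightarrow> frm" (infixr "\<^bold>\<longleftrightarrow>" 25) where
  "(P \<^bold>\<longleftrightarrow> Q) = (\<lambda>d. FIff (P d) (Q d))"

definition all :: "(nat \<Rightarrow> frm) \<Rightarrow> frm" (binder "\<^bold>\<forall>" 10) where
  "all P = (\<lambda>d. FAll (P d (Suc d)))"

definition ex :: "(nat \<Rightarrow> frm) \<Rightarrow> frm" (binder "\<^bold>\<exists>" 10) where
  "ex P = (\<lambda>d. FEx (P d (Suc d)))"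

text \<open>
  \<open>app p [x\<^sub>1, \<dots>, x\<^sub>n]\<close> is the formula \<^term>\<open>p\<close> with its free variables
  \<open>0, \<dots>, n - 1\<close> replaced by \<open>x\<^sub>1, \<dots>, x\<^sub>n\<close>. The remaining free variables of
  \<^term>\<open>p\<close> are parameters; they stay free, and \<^term>\<open>sentence\<close> quantifies them
  universally in front of the whole formula.
\<close>

definition app :: "fm \<Rightarrow> nat list \<Rightarrow> frm" where
  "app p xs = (\<lambda>d. ren (\<lambda>i. if i < length xs then d - Suc (xs ! i) else d + (i - length xs)) p)"

definition sentence :: "frm \<Rightarrow> fm" where
  "sentence P = ucl (P 0)"


section \<open>Elementary set theory\<close>

definition Subset :: "nat \<Rightarrow> nat \<Rightarrow> frm" where
  "Subset x y = (\<^bold>\<forall>z. z \<^bold>\<in> x \<^bold>\<longrightarrow> z \<^bold>\<in> y)"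

definition Empty :: "nat \<Rightarrow> frm" where
  "Empty x = (\<^bold>\<forall>y. \<^bold>\<not> y \<^bold>\<in> x)"

definition UPair :: "nat \<Rightarrow> nat \<Rightarrow> nat \<Rightarrow> frm" where
  "UPair z x y = (\<^bold>\<forall>w. w \<^bold>\<in> z \<^bold>\<longleftrightarrow> w \<^bold>= x \<^bold>\<or> w \<^bold>= y)"

definition OPair :: "nat \<Rightarrow> nat \<Rightarrow> nat \<Rightarrow> frm" where
  "OPair z x y = (\<^bold>\<exists>u. \<^bold>\<exists>v. UPair u x x \<^bold>\<and> UPair v x y \<^bold>\<and> UPair z u v)"

definition Union :: "nat \<Rightarrow> nat \<Rightarrow> frm" where
  "Union z x = (\<^bold>\<forall>w. w \<^bold>\<in> z \<^bold>\<longleftrightarrow> (\<^bold>\<exists>y. y \<^bold>\<in> x \<^bold>\<and> w \<^bold>\<in> y))"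

definition Product :: "nat \<Rightarrow> nat \<Rightarrow> nat \<Rightarrow> frm" where
  "Product z x y = (\<^bold>\<forall>w. w \<^bold>\<in> z \<^bold>\<longleftrightarrow> (\<^bold>\<exists>a. \<^bold>\<exists>b. a \<^bold>\<in> x \<^bold>\<and> b \<^bold>\<in> y \<^bold>\<and> OPair w a b))"

definition Succ :: "nat \<Rightarrow> nat \<Rightarrow> frm" where
  "Succ y x = (\<^bold>\<forall>w. w \<^bold>\<in> y \<^bold>\<longleftrightarrow> w \<^bold>\<in> x \<^bold>\<or> w \<^bold>= x)"

text \<open>Foundation is not available, so irreflexivity and transitivity of the order are stated.\<close>

definition LinOrd :: "nat \<Rightarrow> frm" where
  "LinOrd x =
    ((\<^bold>\<forall>y. y \<^bold>\<in> x \<^bold>\<longrightarrow> \<^bold>\<not> y \<^bold>\<in> y) \<^bold>\<and>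
     (\<^bold>\<forall>y. \<^bold>\<forall>z. \<^bold>\<forall>w. y \<^bold>\<in> x \<^bold>\<and> z \<^bold>\<in> x \<^bold>\<and> w \<^bold>\<in> x \<^bold>\<and> y \<^bold>\<in> z \<^bold>\<and> z \<^bold>\<in> w \<^bold>\<longrightarrow> y \<^bold>\<in> w) \<^bold>\<and>
     (\<^bold>\<forall>y. \<^bold>\<forall>z. y \<^bold>\<in> x \<^bold>\<and> z \<^bold>\<in> x \<^bold>\<longrightarrow> y \<^bold>\<in> z \<^bold>\<or> y \<^bold>= z \<^bold>\<or> z \<^bold>\<in> y))"

definition Ord :: "nat \<Rightarrow> frm" where
  "Ord x = ((\<^bold>\<forall>y. y \<^bold>\<in> x \<^bold>\<longrightarrow> Subset y x) \<^bold>\<and> LinOrd x)"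

definition Nat :: "nat \<Rightarrow> frm" where
  "Nat x = (Ord x \<^bold>\<and>
     (\<^bold>\<forall>y. y \<^bold>\<in> x \<^bold>\<or> y \<^bold>= x \<^bold>\<longrightarrow> Empty y \<^bold>\<or> (\<^bold>\<exists>z. z \<^bold>\<in> y \<^bold>\<and> Succ y z)))"

definition Extensionality :: fm where
  "Extensionality = sentence (\<^bold>\<forall>x. \<^bold>\<forall>y. (\<^bold>\<forall>z. z \<^bold>\<in> x \<^bold>\<longleftrightarrow> z \<^bold>\<in> y) \<^bold>\<longrightarrow> x \<^bold>= y)"

definition Empty_Set :: fm where
  "Empty_Set = sentence (\<^bold>\<exists>x. Empty x)"

definition Pairing :: fm where
  "Pairing = sentence (\<^bold>\<forall>x. \<^bold>\<forall>y. \<^bold>\<exists>z. UPair z x y)"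

definition Union_Ax :: fm where
  "Union_Ax = sentence (\<^bold>\<forall>x. \<^bold>\<exists>z. Union z x)"

definition Cartesian_Product :: fm where
  "Cartesian_Product = sentence (\<^bold>\<forall>x. \<^bold>\<forall>y. \<^bold>\<exists>z. Product z x y)"

definition separation :: "fm \<Rightarrow> fm" where
  "separation p = sentence (\<^bold>\<forall>a. \<^bold>\<exists>b. \<^bold>\<forall>x. x \<^bold>\<in> b \<^bold>\<longleftrightarrow> x \<^bold>\<in> a \<^bold>\<and> app p [x])"

definition induction :: "fm \<Rightarrow> fm" where
  "induction p = sentence
    ((\<^bold>\<forall>x. app p [x] \<^bold>\<longrightarrow> Nat x) \<^bold>\<longrightarrow>
     (\<^bold>\<exists>x. Empty x \<^bold>\<and> app p [x]) \<^bold>\<and>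
     (\<^bold>\<forall>x. Nat x \<^bold>\<longrightarrow> app p [x] \<^bold>\<longrightarrow> (\<^bold>\<exists>y. Succ y x \<^bold>\<and> app p [y])) \<^bold>\<longrightarrow>
     (\<^bold>\<forall>x. Nat x \<^bold>\<longrightarrow> app p [x]))"

definition replacement :: "fm \<Rightarrow> fm" where
  "replacement p = sentence
    ((\<^bold>\<forall>x. \<^bold>\<forall>y. \<^bold>\<forall>z. app p [x, y] \<^bold>\<and> app p [x, z] \<^bold>\<longrightarrow> y \<^bold>= z) \<^bold>\<longrightarrow>
     (\<^bold>\<forall>a. \<^bold>\<exists>b. \<^bold>\<forall>y. y \<^bold>\<in> b \<^bold>\<longleftrightarrow> (\<^bold>\<exists>x. x \<^bold>\<in> a \<^bold>\<and> app p [x, y])))"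

definition EST :: "fm set" where
  "EST = {Extensionality, Empty_Set, Pairing, Union_Ax, Cartesian_Product}
     \<union> {separation p | p. delta0 p} \<union> range induction"

definition Delta0_Replacement :: "fm set" where
  "Delta0_Replacement = {replacement p | p. delta0 p}"

definition Replacement :: "fm set" where
  "Replacement = range replacement"


section \<open>Structures and satisfaction inside set theory\<close>

text \<open>\<^term>\<open>Maps_to f x y\<close> says that the pair of \<^term>\<open>x\<close> and \<^term>\<open>y\<close> belongs to \<^term>\<open>f\<close>.\<close>

definition Maps_to :: "nat \<Rightarrow> nat \<Rightarrow> nat \<Rightarrow> frm" where
  "Maps_to f x y = (\<^bold>\<exists>z. OPair z x y \<^bold>\<and> z \<^bold>\<in> f)"

definition Function_on :: "nat \<Rightarrow> nat \<Rightarrow> frm" where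
  "Function_on f a =
    ((\<^bold>\<forall>z. z \<^bold>\<in> f \<^bold>\<longrightarrow> (\<^bold>\<exists>x. \<^bold>\<exists>y. x \<^bold>\<in> a \<^bold>\<and> OPair z x y)) \<^bold>\<and>
     (\<^bold>\<forall>x. x \<^bold>\<in> a \<^bold>\<longrightarrow> (\<^bold>\<exists>y. Maps_to f x y)) \<^bold>\<and>
     (\<^bold>\<forall>x. \<^bold>\<forall>y. \<^bold>\<forall>z. Maps_to f x y \<^bold>\<and> Maps_to f x z \<^bold>\<longrightarrow> y \<^bold>= z))"

definition Function :: "nat \<Rightarrow> nat \<Rightarrow> nat \<Rightarrow> frm" where
  "Function f a b = (Function_on f a \<^bold>\<and> (\<^bold>\<forall>x. \<^bold>\<forall>y. Maps_to f x y \<^bold>\<longrightarrow> y \<^bold>\<in> b))"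

text \<open>
  The flags \<^term>\<open>u\<close> and \<^term>\<open>r\<close> tell whether the predicate symbols \<open>U\<close> and \<open>R\<close>
  belong to the language. Structures are the tuples \<open>\<langle>M, U, R, I\<rangle>\<close>, \<open>\<langle>M, U, I\<rangle>\<close>,
  \<open>\<langle>M, R, I\<rangle>\<close> or \<open>\<langle>M, I\<rangle>\<close> accordingly, with \<open>\<langle>a, b, c\<rangle> = \<langle>\<langle>a, b\<rangle>, c\<rangle>\<close>; the variable for an
  omitted component is set to the empty set and plays no role.
\<close>

definition Structure :: "bool \<Rightarrow> bool \<Rightarrow> nat \<Rightarrow> nat \<Rightarrow> nat \<Rightarrow> nat \<Rightarrow> nat \<Rightarrow> nat \<Rightarrow> frm" where
  "Structure u r A S M U R I =
    ((\<^bold>\<exists>v. \<^bold>\<exists>w. (if u then OPair v M U else v \<^bold>= M \<^bold>\<and> Empty U) \<^bold>\<and>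
            (if r then OPair w v R else w \<^bold>= v \<^bold>\<and> Empty R) \<^bold>\<and>
            OPair S w I) \<^bold>\<and>
     Subset U M \<^bold>\<and>
     (\<^bold>\<forall>z. z \<^bold>\<in> R \<^bold>\<longrightarrow> (\<^bold>\<exists>x. \<^bold>\<exists>y. x \<^bold>\<in> M \<^bold>\<and> y \<^bold>\<in> M \<^bold>\<and> OPair z x y)) \<^bold>\<and>
     Function I A M)"

subsection \<open>Codes of terms and formulas\<close>

text \<open>
  Terms: \<open>v\<^sub>n\<close> is \<open>\<langle>0, n\<rangle>\<close> and \<open>c\<^sub>a\<close> is \<open>\<langle>1, a\<rangle>\<close>. Formulas: \<open>s = t\<close>, \<open>U(t)\<close>, \<open>R(s, t)\<close>,
  \<open>\<not>p\<close>, \<open>p \<and> q\<close>, \<open>\<exists>v\<^sub>n p\<close> are \<open>\<langle>0, \<langle>s, t\<rangle>\<rangle>\<close>, \<open>\<langle>1, t\<rangle>\<close>, \<open>\<langle>2, \<langle>s, t\<rangle>\<rangle>\<close>, \<open>\<langle>3, p\<rangle>\<close>,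
  \<open>\<langle>4, \<langle>p, q\<rangle>\<rangle>\<close>, \<open>\<langle>5, \<langle>n, p\<rangle>\<rangle>\<close>.
\<close>

primrec Numeral :: "nat \<Rightarrow> nat \<Rightarrow> frm" where
  "Numeral 0 x = Empty x"
| "Numeral (Suc n) x = (\<^bold>\<exists>y. Numeral n y \<^bold>\<and> Succ x y)"

definition Tag :: "nat \<Rightarrow> nat \<Rightarrow> nat \<Rightarrow> frm" where
  "Tag n z x = (\<^bold>\<exists>t. Numeral n t \<^bold>\<and> OPair z t x)"

definition Tag2 :: "nat \<Rightarrow> nat \<Rightarrow> nat \<Rightarrow> nat \<Rightarrow> frm" where
  "Tag2 n z x y = (\<^bold>\<exists>w. OPair w x y \<^bold>\<and> Tag n z w)"

abbreviation "CVar \<equiv> Tag 0"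
abbreviation "CConst \<equiv> Tag 1"
abbreviation "CEq \<equiv> Tag2 0"
abbreviation "CU \<equiv> Tag 1"
abbreviation "CR \<equiv> Tag2 2"
abbreviation "CNeg \<equiv> Tag 3"
abbreviation "CAnd \<equiv> Tag2 4"
abbreviation "CEx \<equiv> Tag2 5"

text \<open>Terms and atomic formulas whose variables are among \<open>v\<^sub>n\<close>, \<open>n < k\<close>.\<close>

definition Term :: "nat \<Rightarrow> nat \<Rightarrow> nat \<Rightarrow> frm" where
  "Term A k z = ((\<^bold>\<exists>n. n \<^bold>\<in> k \<^bold>\<and> CVar z n) \<^bold>\<or> (\<^bold>\<exists>a. a \<^bold>\<in> A \<^bold>\<and> CConst z a))"

definition Atom :: "bool \<Rightarrow> bool \<Rightarrow> nat \<Rightarrow> nat \<Rightarrow> nat \<Rightarrow> frm" where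
  "Atom u r A k z =
    (let EqAtom = \<^bold>\<exists>x. \<^bold>\<exists>y. Term A k x \<^bold>\<and> Term A k y \<^bold>\<and> CEq z x y;
         UAtom = \<^bold>\<exists>x. Term A k x \<^bold>\<and> CU z x;
         RAtom = \<^bold>\<exists>x. \<^bold>\<exists>y. Term A k x \<^bold>\<and> Term A k y \<^bold>\<and> CR z x y
     in if u then (if r then EqAtom \<^bold>\<or> UAtom \<^bold>\<or> RAtom else EqAtom \<^bold>\<or> UAtom)
             else (if r then EqAtom \<^bold>\<or> RAtom else EqAtom))"

text \<open>
  \<^term>\<open>g\<close> is a formation sequence \<open>g(0), \<dots>, g(N)\<close> of formulas of the language with
  variables (free or bound) among \<open>v\<^sub>n\<close>, \<open>n < k\<close>.
\<close>

definition Formation :: "bool \<Rightarrow> bool \<Rightarrow> nat \<Rightarrow> nat \<Rightarrow> nat \<Rightarrow> nat \<Rightarrow> frm" where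
  "Formation u r A k N g =
    (Nat k \<^bold>\<and> Nat N \<^bold>\<and>
     (\<^bold>\<exists>D. Succ D N \<^bold>\<and> Function_on g D) \<^bold>\<and>
     (\<^bold>\<forall>i. \<^bold>\<forall>z. Maps_to g i z \<^bold>\<longrightarrow>
        Atom u r A k z \<^bold>\<or>
        (\<^bold>\<exists>j. \<^bold>\<exists>p. j \<^bold>\<in> i \<^bold>\<and> Maps_to g j p \<^bold>\<and> CNeg z p) \<^bold>\<or>
        (\<^bold>\<exists>j. \<^bold>\<exists>l. \<^bold>\<exists>p. \<^bold>\<exists>q. j \<^bold>\<in> i \<^bold>\<and> l \<^bold>\<in> i \<^bold>\<and> Maps_to g j p \<^bold>\<and> Maps_to g l q \<^bold>\<and> CAnd z p q) \<^bold>\<or>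
        (\<^bold>\<exists>n. \<^bold>\<exists>j. \<^bold>\<exists>p. n \<^bold>\<in> k \<^bold>\<and> j \<^bold>\<in> i \<^bold>\<and> Maps_to g j p \<^bold>\<and> CEx z n p)))"

definition Formula :: "bool \<Rightarrow> bool \<Rightarrow> nat \<Rightarrow> nat \<Rightarrow> nat \<Rightarrow> frm" where
  "Formula u r A k p = (\<^bold>\<exists>N. \<^bold>\<exists>g. Formation u r A k N g \<^bold>\<and> Maps_to g N p)"

subsection \<open>Satisfaction\<close>

definition Term_Value :: "nat \<Rightarrow> nat \<Rightarrow> nat \<Rightarrow> nat \<Rightarrow> frm" where
  "Term_Value I s t a =
    ((\<^bold>\<exists>n. CVar t n \<^bold>\<and> Maps_to s n a) \<^bold>\<or> (\<^bold>\<exists>c. CConst t c \<^bold>\<and> Maps_to I c a))"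

text \<open>
  Without Replacement or Power Set, the functions from \<open>k\<close> to \<open>M\<close> need not form a set, but the
  iterated product \<open>M\<^sup>0 = {\<emptyset>}\<close>, \<open>M\<^sup>i\<^sup>+\<^sup>1 = M\<^sup>i \<times> M\<close> does exist. Sets of assignments are
  therefore sets of tuples: \<^term>\<open>Tuple k s t\<close> says that
  \<open>t = \<langle>\<dots>\<langle>\<langle>\<emptyset>, s(0)\<rangle>, s(1)\<rangle>\<dots>, s(k - 1)\<rangle>\<close>.
\<close>

definition Tuple :: "nat \<Rightarrow> nat \<Rightarrow> nat \<Rightarrow> frm" where
  "Tuple k s t =
    (\<^bold>\<exists>w. (\<^bold>\<exists>D. Succ D k \<^bold>\<and> Function_on w D) \<^bold>\<and>
       (\<^bold>\<exists>e. Empty e \<^bold>\<and> Maps_to w e e) \<^bold>\<and>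
       (\<^bold>\<forall>i. i \<^bold>\<in> k \<^bold>\<longrightarrow>
          (\<^bold>\<exists>j. \<^bold>\<exists>x. \<^bold>\<exists>y. \<^bold>\<exists>a. Succ j i \<^bold>\<and> Maps_to w i x \<^bold>\<and> Maps_to w j y \<^bold>\<and>
             Maps_to s i a \<^bold>\<and> OPair y x a)) \<^bold>\<and>
       Maps_to w k t)"

text \<open>The tuple of the assignment \<open>s\<close> belongs to \<open>h(i)\<close>.\<close>

definition Holds :: "nat \<Rightarrow> nat \<Rightarrow> nat \<Rightarrow> nat \<Rightarrow> frm" where
  "Holds k h i s = (\<^bold>\<exists>H. \<^bold>\<exists>t. Maps_to h i H \<^bold>\<and> Tuple k s t \<^bold>\<and> t \<^bold>\<in> H)"

text \<open>
  \<open>h(i)\<close> is the set of assignments satisfying the formula \<open>g(i)\<close>, for all \<open>i \<le> N\<close>: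
  Tarski's clauses along the formation sequence \<open>g\<close>.
\<close>

definition Evaluation ::
    "nat \<Rightarrow> nat \<Rightarrow> nat \<Rightarrow> nat \<Rightarrow> nat \<Rightarrow> nat \<Rightarrow> nat \<Rightarrow> nat \<Rightarrow> frm" where
  "Evaluation M U R I k N g h =
    ((\<^bold>\<exists>D. Succ D N \<^bold>\<and> Function_on h D) \<^bold>\<and>
     (\<^bold>\<forall>i. \<^bold>\<forall>z. \<^bold>\<forall>s. Maps_to g i z \<^bold>\<and> Function s k M \<^bold>\<longrightarrow>
       (Holds k h i s \<^bold>\<longleftrightarrow>
          (\<^bold>\<exists>x. \<^bold>\<exists>y. \<^bold>\<exists>a. CEq z x y \<^bold>\<and> Term_Value I s x a \<^bold>\<and> Term_Value I s y a) \<^bold>\<or>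
          (\<^bold>\<exists>x. \<^bold>\<exists>a. CU z x \<^bold>\<and> Term_Value I s x a \<^bold>\<and> a \<^bold>\<in> U) \<^bold>\<or>
          (\<^bold>\<exists>x. \<^bold>\<exists>y. \<^bold>\<exists>a. \<^bold>\<exists>b. CR z x y \<^bold>\<and> Term_Value I s x a \<^bold>\<and> Term_Value I s y b \<^bold>\<and>
             Maps_to R a b) \<^bold>\<or>
          (\<^bold>\<exists>j. \<^bold>\<exists>p. j \<^bold>\<in> i \<^bold>\<and> Maps_to g j p \<^bold>\<and> CNeg z p \<^bold>\<and> \<^bold>\<not> Holds k h j s) \<^bold>\<or>
          (\<^bold>\<exists>j. \<^bold>\<exists>l. \<^bold>\<exists>p. \<^bold>\<exists>q. j \<^bold>\<in> i \<^bold>\<and> l \<^bold>\<in> i \<^bold>\<and> Maps_to g j p \<^bold>\<and> Maps_to g l q \<^bold>\<and> CAnd z p q \<^bold>\<and>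
             Holds k h j s \<^bold>\<and> Holds k h l s) \<^bold>\<or>
          (\<^bold>\<exists>n. \<^bold>\<exists>j. \<^bold>\<exists>p. n \<^bold>\<in> k \<^bold>\<and> j \<^bold>\<in> i \<^bold>\<and> Maps_to g j p \<^bold>\<and> CEx z n p \<^bold>\<and>
             (\<^bold>\<exists>s'. Function s' k M \<^bold>\<and>
                (\<^bold>\<forall>m. \<^bold>\<forall>a. \<^bold>\<not> m \<^bold>= n \<^bold>\<longrightarrow> (Maps_to s' m a \<^bold>\<longleftrightarrow> Maps_to s m a)) \<^bold>\<and>
                Holds k h j s')))))"

definition Satisfies ::
    "bool \<Rightarrow> bool \<Rightarrow> nat \<Rightarrow> nat \<Rightarrow> nat \<Rightarrow> nat \<Rightarrow> nat \<Rightarrow> nat \<Rightarrow> nat \<Rightarrow> nat \<Rightarrow> frm" where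
  "Satisfies u r A M U R I k p s =
    (\<^bold>\<exists>N. \<^bold>\<exists>g. \<^bold>\<exists>h. Formation u r A k N g \<^bold>\<and> Maps_to g N p \<^bold>\<and>
       Evaluation M U R I k N g h \<^bold>\<and> Holds k h N s)"

definition Elementary_Embedding :: "bool \<Rightarrow> bool \<Rightarrow> nat \<Rightarrow> nat \<Rightarrow> nat \<Rightarrow> nat \<Rightarrow> frm" where
  "Elementary_Embedding u r A S S' f =
    (\<^bold>\<exists>M. \<^bold>\<exists>U. \<^bold>\<exists>R. \<^bold>\<exists>I. \<^bold>\<exists>M'. \<^bold>\<exists>U'. \<^bold>\<exists>R'. \<^bold>\<exists>I'.
       Structure u r A S M U R I \<^bold>\<and> Structure u r A S' M' U' R' I' \<^bold>\<and>
       Function f M M' \<^bold>\<and>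
       (\<^bold>\<forall>x. \<^bold>\<forall>y. \<^bold>\<forall>z. Maps_to f x z \<^bold>\<and> Maps_to f y z \<^bold>\<longrightarrow> x \<^bold>= y) \<^bold>\<and>
       (\<^bold>\<forall>k. \<^bold>\<forall>p. \<^bold>\<forall>s. \<^bold>\<forall>s'.
          Formula u r A k p \<^bold>\<and> Function s k M \<^bold>\<and> Function s' k M' \<^bold>\<and>
          (\<^bold>\<forall>n. \<^bold>\<forall>a. \<^bold>\<forall>b. Maps_to s n a \<^bold>\<and> Maps_to f a b \<^bold>\<longrightarrow> Maps_to s' n b) \<^bold>\<longrightarrow>
          (Satisfies u r A M U R I k p s \<^bold>\<longleftrightarrow> Satisfies u r A M' U' R' I' k p s')))"


section \<open>Vopenka's principle\<close>

definition Proper_Class :: "fm \<Rightarrow> frm" where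
  "Proper_Class p =
    (\<^bold>\<forall>x. \<^bold>\<exists>y. (app p [y] \<^bold>\<and> \<^bold>\<not> y \<^bold>\<in> x) \<^bold>\<or> (\<^bold>\<not> app p [y] \<^bold>\<and> y \<^bold>\<in> x))"

definition vopenka :: "bool \<Rightarrow> bool \<Rightarrow> fm \<Rightarrow> fm" where
  "vopenka u r p = sentence
    (\<^bold>\<forall>A. Proper_Class p \<^bold>\<and>
       (\<^bold>\<forall>S. app p [S] \<^bold>\<longrightarrow> (\<^bold>\<exists>M. \<^bold>\<exists>U. \<^bold>\<exists>R. \<^bold>\<exists>I. Structure u r A S M U R I)) \<^bold>\<longrightarrow>
       (\<^bold>\<exists>S. \<^bold>\<exists>S'. app p [S] \<^bold>\<and> app p [S'] \<^bold>\<and> \<^bold>\<not> S \<^bold>= S' \<^bold>\<and>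
          (\<^bold>\<exists>f. Elementary_Embedding u r A S S' f)))"

definition VP :: "fm set" where
  "VP = {vopenka u r p | u r p. True}"

end

theory Submission
  imports Defs "HOL-Library.Countable" "HOL-Library.Infinite_Set"
begin

text \<open>
  By completeness it suffices to verify Replacement in every model of EST + VP. Let \<open>F\<close> be a
  functional class and \<open>a\<close> a set. For \<open>x \<in> a\<close> with \<open>y = F(x)\<close> let \<open>S\<^sub>x\<close> be the structure with
  universe \<open>a \<times> {y}\<close>, with \<open>U = {\<langle>x, y\<rangle>}\<close>, and with \<open>c\<^sub>b\<close> interpreted as \<open>\<langle>b, y\<rangle>\<close> for \<open>b \<in> a\<close>.
  The sentence \<open>U(c\<^sub>x)\<close> is true in \<open>S\<^sub>x\<close> and false in \<open>S\<^sub>z\<close> for \<open>z \<noteq> x\<close>, so no two of these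
  structures are related by an elementary embedding. By VP they do not form a proper class, and
  from the set of the \<open>S\<^sub>x\<close> the image of \<open>a\<close> is obtained by Union and \<open>\<Delta>\<^sub>0\<close>-Separation.
  The argument is uniform in the complexity of \<open>F\<close>, so it gives all three claims at once.
\<close>

section \<open>Completeness\<close>

lemma weaken: "\<Gamma> \<turnstile> p \<Longrightarrow> \<Gamma> \<subseteq> \<Delta> \<Longrightarrow> \<Delta> \<turnstile> p"
proof (induction arbitrary: \<Delta> rule: proves.induct)
  case (ImpI p \<Gamma> q)
  then show ?case by (meson insert_mono proves.ImpI)
next
  case (Contr p \<Gamma>)
  then show ?case by (meson insert_mono proves.Contr)
next
  case (AllI \<Gamma> p)
  then show ?case by (meson image_mono proves.AllI)
next
  case (EqE \<Gamma> x y p)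
  then show ?case by (meson proves.EqE)
qed (auto intro: proves.intros)

lemma ren_cong: "(\<And>i. i < fbound p \<Longrightarrow> f i = g i) \<Longrightarrow> ren f p = ren g p"
proof (induction p arbitrary: f g)
  case (FImp p q)
  have "ren f p = ren g p" by (rule FImp.IH(1)) (simp add: FImp.prems)
  moreover have "ren f q = ren g q" by (rule FImp.IH(2)) (simp add: FImp.prems)
  ultimately show ?case by simp
next
  case (FAll p)
  have "ren (case_nat 0 (\<lambda>i. Suc (f i))) p = ren (case_nat 0 (\<lambda>i. Suc (g i))) p"
    by (rule FAll.IH) (use FAll.prems in \<open>auto split: nat.split\<close>)
  then show ?case by simp
qed auto

lemma ren_ren: "ren f (ren g p) = ren (f \<circ> g) p"
proof (induction p arbitrary: f g)
  case (FAll p)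
  have "case_nat 0 (\<lambda>i. Suc (f i)) \<circ> case_nat 0 (\<lambda>i. Suc (g i)) = case_nat 0 (\<lambda>i. Suc ((f \<circ> g) i))"
    by (auto simp: fun_eq_iff split: nat.split)
  then show ?case by (simp add: FAll.IH)
qed auto

lemma ren_id: "ren (\<lambda>i. i) p = p"
proof (induction p)
  case (FAll p)
  have "case_nat 0 Suc = (\<lambda>i. i)" by (auto simp: fun_eq_iff split: nat.split)
  then show ?case by (simp add: FAll.IH)
qed auto

lemma ren_lift: "ren (case_nat 0 (\<lambda>i. Suc (f i))) (lift p) = lift (ren f p)"
  by (simp add: lift_def ren_ren comp_def)

lemma ren_inst: "ren f (inst x p) = inst (f x) (ren (case_nat 0 (\<lambda>i. Suc (f i))) p)"
  unfolding inst_def ren_ren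
  by (rule arg_cong[of _ _ "\<lambda>h. ren h p"]) (auto simp: fun_eq_iff split: nat.split)

lemma inst_ren: "inst x (ren (case_nat 0 (\<lambda>i. Suc (f i))) p) = ren (case_nat x f) p"
  unfolding inst_def ren_ren
  by (rule arg_cong[of _ _ "\<lambda>h. ren h p"]) (auto simp: fun_eq_iff split: nat.split)

lemma proves_ren: "\<Gamma> \<turnstile> p \<Longrightarrow> ren f ` \<Gamma> \<turnstile> ren f p"
proof (induction arbitrary: f rule: proves.induct)
  case (AllI \<Gamma> p)
  have "lift ` ren f ` \<Gamma> = ren (case_nat 0 (\<lambda>i. Suc (f i))) ` lift ` \<Gamma>"
    by (simp add: image_image ren_lift)
  with AllI.IH show ?case by (simp add: proves.AllI)
next
  case (AllE \<Gamma> p x)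
  then show ?case unfolding ren_inst using proves.AllE by fastforce
next
  case (EqE \<Gamma> x y p)
  then show ?case unfolding ren_inst using proves.EqE by fastforce
qed (auto intro: proves.intros)

text \<open>A derivation mentions only finitely many assumptions. This lets consistency pass from
  the finite Henkin stages to their union.\<close>

lemma proves_finite: "\<Gamma> \<turnstile> p \<Longrightarrow> \<exists>F\<subseteq>\<Gamma>. finite F \<and> F \<turnstile> p"
proof (induction rule: proves.induct)
  case (Assm p \<Gamma>)
  then show ?case by (intro exI[of _ "{p}"]) (auto intro: proves.Assm)
next
  case (ImpI p \<Gamma> q)
  then obtain F where "F \<subseteq> insert p \<Gamma>" "finite F" "F \<turnstile> q" by blast
  then show ?case
    by (intro exI[of _ "F - {p}"]) (auto intro!: proves.ImpI elim!: weaken)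
next
  case (ImpE \<Gamma> p q)
  then obtain F F' where "F \<subseteq> \<Gamma>" "finite F" "F \<turnstile> FImp p q" "F' \<subseteq> \<Gamma>" "finite F'" "F' \<turnstile> p" by blast
  then show ?case
    by (intro exI[of _ "F \<union> F'"]) (auto intro!: proves.ImpE[of _ p q] elim!: weaken)
next
  case (Contr p \<Gamma>)
  then obtain F where "F \<subseteq> insert (FNeg p) \<Gamma>" "finite F" "F \<turnstile> FBot" by blast
  then show ?case
    by (intro exI[of _ "F - {FNeg p}"]) (auto intro!: proves.Contr[of p] elim!: weaken)
next
  case (AllI \<Gamma> p)
  then obtain F where "F \<subseteq> lift ` \<Gamma>" "finite F" "F \<turnstile> p" by blast
  then obtain C where "C \<subseteq> \<Gamma>" "finite C" "F = lift ` C" by (meson finite_subset_image)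
  with \<open>F \<turnstile> p\<close> show ?case by (auto intro: proves.AllI)
next
  case (EqI \<Gamma> x)
  then show ?case by (intro exI[of _ "{}"]) (auto intro: proves.EqI)
next
  case (EqE \<Gamma> x y p)
  then obtain F F' where "F \<subseteq> \<Gamma>" "finite F" "F \<turnstile> FEq x y" "F' \<subseteq> \<Gamma>" "finite F'" "F' \<turnstile> inst x p" by blast
  then show ?case
    by (intro exI[of _ "F \<union> F'"]) (auto intro!: proves.EqE[of _ x y p] elim!: weaken)
qed (auto intro: proves.AllE)

text \<open>Turns the context-shifting rule \<open>AllI\<close> into generalisation over a fresh
  variable. The renaming that sends \<open>y\<close> to 0 and every other \<open>i\<close> to
  \<open>Suc i\<close> acts on \<open>\<Gamma>\<close> as \<open>lift\<close>, since
  \<open>y\<close> does not occur there, and it undoes the instantiation of \<open>q\<close> by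
  \<open>y\<close>.\<close>

lemma AllI_fresh:
  assumes "\<And>p. p \<in> \<Gamma> \<Longrightarrow> fbound p \<le> y" "fbound q \<le> Suc y" "\<Gamma> \<turnstile> inst y q"
  shows "\<Gamma> \<turnstile> FAll q"
proof -
  define f where "f i = (if i = y then 0 else Suc i)" for i
  have "ren f p = lift p" if "p \<in> \<Gamma>" for p
    unfolding lift_def by (rule ren_cong) (use assms(1)[OF that] in \<open>auto simp: f_def\<close>)
  then have "ren f ` \<Gamma> = lift ` \<Gamma>" by auto
  moreover have "ren f (inst y q) = ren (\<lambda>i. i) q"
    unfolding inst_def ren_ren
    by (rule ren_cong) (use assms(2) in \<open>auto simp: f_def split: nat.split\<close>)
  ultimately show ?thesis
    using proves_ren[OF assms(3), of f] by (auto simp: ren_id intro: proves.AllI)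
qed

lemma fbound_ucl: "fbound (ucl p) = 0"
proof -
  have "fbound ((FAll ^^ n) p) = fbound p - n" for n by (induction n) auto
  then show ?thesis by (simp add: ucl_def)
qed

section \<open>Henkin extensions, built along an enumeration of the formulas\<close>

instance fm :: countable by countable_datatype

definition consistent :: "fm set \<Rightarrow> bool" where
  "consistent \<Gamma> \<longleftrightarrow> \<not> \<Gamma> \<turnstile> FBot"

lemma ImpI_inconsistent: "\<not> consistent (insert p \<Gamma>) \<Longrightarrow> \<Gamma> \<turnstile> FNeg p"
  by (simp add: consistent_def proves.ImpI)

lemma consistent_mono: "consistent \<Delta> \<Longrightarrow> \<Gamma> \<subseteq> \<Delta> \<Longrightarrow> consistent \<Gamma>"
  unfolding consistent_def using weaken by blast

text \<open>If the witness formula were inconsistent with \<open>\<Gamma>\<close>, then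
  \<open>\<Gamma>\<close> would prove \<open>inst y q\<close> for a fresh \<open>y\<close>, hence
  \<open>FAll q\<close>, which it refutes.\<close>

lemma consistent_witness:
  assumes "\<And>p. p \<in> \<Gamma> \<Longrightarrow> fbound p \<le> y" "fbound q \<le> Suc y"
    and "consistent \<Gamma>" "FNeg (FAll q) \<in> \<Gamma>"
  shows "consistent (insert (FNeg (inst y q)) \<Gamma>)"
proof (rule ccontr)
  assume "\<not> ?thesis"
  then have "\<Gamma> \<turnstile> inst y q" by (simp add: consistent_def proves.Contr)
  then have "\<Gamma> \<turnstile> FAll q" using AllI_fresh assms(1,2) by blast
  with assms(3,4) show False unfolding consistent_def using proves.ImpE proves.Assm by blast
qed

text \<open>The theory \<open>T\<close> consists of sentences and only finitely many formulas
  \<open>L\<close> have been added, so a variable above all free variables of \<open>p\<close>,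
  \<open>q\<close> and \<open>L\<close> is fresh for everything. Variables can therefore serve as
  Henkin witnesses, and the language stays without constants.\<close>

lemma henkin_step:
  assumes T: "\<forall>p\<in>T. fbound p = 0" and "finite L" "consistent (T \<union> L)"
  shows "\<exists>L'. finite L' \<and> consistent (T \<union> L') \<and> L \<subseteq> L' \<and>
    (p \<in> L' \<or> \<not> consistent (insert p (T \<union> L'))) \<and>
    (\<forall>q. p = FNeg (FAll q) \<and> p \<in> L' \<longrightarrow> (\<exists>y. FNeg (inst y q) \<in> L'))"
proof (cases "consistent (insert p (T \<union> L))")
  case False
  have "p \<notin> L" using False assms(3) by (auto simp: insert_absorb)
  with False assms show ?thesis by (intro exI[of _ L]) auto
next
  case con: True
  show ?thesis
  proof (cases "\<exists>q. p = FNeg (FAll q)")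
    case False
    with con assms show ?thesis by (intro exI[of _ "insert p L"]) auto
  next
    case True
    then obtain q where q: "p = FNeg (FAll q)" ..
    define y where "y = Max (insert (fbound q) (fbound ` insert p L))"
    have y: "fbound r \<le> y" if "r = q \<or> r \<in> insert p (T \<union> L)" for r
    proof (cases "r \<in> T")
      case False
      with that have "fbound r \<in> insert (fbound q) (fbound ` insert p L)" by auto
      then show ?thesis unfolding y_def by (intro Max_ge) (use assms(2) in auto)
    qed (simp add: T)
    have "consistent (insert (FNeg (inst y q)) (insert p (T \<union> L)))"
      by (rule consistent_witness) (use y con q in \<open>auto intro: le_SucI\<close>)
    with assms q show ?thesis
      by (intro exI[of _ "insert (FNeg (inst y q)) (insert p L)"]) auto
  qed
qed

text \<open>Stage \<open>n\<close> decides the formula with number \<open>n\<close> by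
  \<open>henkin_step\<close>, starting from \<open>{r}\<close>; \<open>H\<close> is the union of
  \<open>T\<close> and all stages. A finite part of \<open>H\<close> already lies in one stage
  together with \<open>T\<close>, so \<open>H\<close> is consistent.\<close>

lemma henkin_extension:
  assumes T: "\<forall>p\<in>T. fbound p = 0" and "consistent (insert r T)"
  obtains H where "insert r T \<subseteq> H" "consistent H"
    "\<And>p. p \<in> H \<or> \<not> consistent (insert p H)"
    "\<And>q. FNeg (FAll q) \<in> H \<Longrightarrow> \<exists>y. FNeg (inst y q) \<in> H"
proof -
  let ?P = "\<lambda>n::nat. \<lambda>L. finite L \<and> consistent (T \<union> L) \<and> r \<in> L"
  let ?Q = "\<lambda>n L L'. L \<subseteq> L' \<and>
    (from_nat n \<in> L' \<or> \<not> consistent (insert (from_nat n) (T \<union> L'))) \<and>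
    (\<forall>q. from_nat n = FNeg (FAll q) \<and> from_nat n \<in> L' \<longrightarrow> (\<exists>y. FNeg (inst y q) \<in> L'))"
  have "\<exists>f. \<forall>n. ?P n (f n) \<and> ?Q n (f n) (f (Suc n))"
  proof (rule dependent_nat_choice)
    show "\<exists>L. ?P 0 L" using assms(2) by (intro exI[of _ "{r}"]) auto
    show "\<exists>L'. ?P (Suc n) L' \<and> ?Q n L L'" if "?P n L" for n L
    proof -
      obtain L' where "finite L' \<and> consistent (T \<union> L') \<and> ?Q n L L'"
        using henkin_step[OF T, where L = L and p = "from_nat n"] \<open>?P n L\<close> by auto
      then show ?thesis using that by (intro exI[of _ L']) auto
    qed
  qed
  then obtain f where f: "\<And>n. ?P n (f n)" "\<And>n. ?Q n (f n) (f (Suc n))" by blast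
  define H where "H = T \<union> (\<Union>n. f n)"
  have mono: "f m \<subseteq> f n" if "m \<le> n" for m n
    using lift_Suc_mono_le[of f] f(2) that by blast
  have fin: "\<exists>n. F \<subseteq> T \<union> f n" if "finite F" "F \<subseteq> H" for F
    using that
  proof (induction F rule: finite_induct)
    case (insert x F)
    then obtain n where "F \<subseteq> T \<union> f n" by auto
    moreover obtain m where "x \<in> T \<union> f m" using insert by (auto simp: H_def)
    ultimately have "insert x F \<subseteq> T \<union> f (max m n)"
      using mono[of m "max m n"] mono[of n "max m n"] by auto
    then show ?case ..
  qed auto
  show thesis
  proof
    show "insert r T \<subseteq> H" using f(1) by (auto simp: H_def)
    show "consistent H"
      unfolding consistent_def
    proof
      assume "H \<turnstile> FBot"
      then obtain F where F: "F \<subseteq> H" "finite F" "F \<turnstile> FBot" using proves_finite by blast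
      then obtain n where "F \<subseteq> T \<union> f n" using fin by blast
      with F f(1)[of n] show False unfolding consistent_def using weaken by blast
    qed
    show "p \<in> H \<or> \<not> consistent (insert p H)" for p
    proof -
      have "p \<in> f (Suc (to_nat p)) \<or> \<not> consistent (insert p (T \<union> f (Suc (to_nat p))))"
        using f(2)[of "to_nat p"] by simp
      moreover have "insert p (T \<union> f (Suc (to_nat p))) \<subseteq> insert p H" by (auto simp: H_def)
      ultimately show ?thesis using consistent_mono by (auto simp: H_def)
    qed
    show "\<exists>y. FNeg (inst y q) \<in> H" if "FNeg (FAll q) \<in> H" for q
    proof -
      let ?p = "FNeg (FAll q)"
      have "?p \<in> f (Suc (to_nat ?p)) \<or> \<not> consistent (insert ?p (T \<union> f (Suc (to_nat ?p))))"
        using f(2)[of "to_nat ?p"] by simp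
      moreover have "insert ?p (T \<union> f (Suc (to_nat ?p))) \<subseteq> H" using that by (auto simp: H_def)
      \<comment> \<open>A member of \<open>H\<close> cannot have been rejected when its own turn
        came, because adding it at that stage yields a subset of the consistent set
        \<open>H\<close>. So its witness was added at that stage.\<close>
      ultimately have "?p \<in> f (Suc (to_nat ?p))"
        using consistent_mono \<open>consistent H\<close> by blast
      then show ?thesis using f(2)[of "to_nat ?p"] by (auto simp: H_def)
    qed
  qed
qed

section \<open>Tarski semantics, the term model, and passage to true equality\<close>

text \<open>The relation \<open>Q\<close> interprets equality; it differs from \<open>(=)\<close> only in the term model below.\<close>

primrec sat :: "('a \<Rightarrow> 'a \<Rightarrow> bool) \<Rightarrow> ('a \<Rightarrow> 'a \<Rightarrow> bool) \<Rightarrow> (nat \<Rightarrow> 'a) \<Rightarrow> fm \<Rightarrow> bool" where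
  "sat Q E e (FEq i j) = Q (e i) (e j)"
| "sat Q E e (FMem i j) = E (e i) (e j)"
| "sat Q E e FBot = False"
| "sat Q E e (FImp p q) = (sat Q E e p \<longrightarrow> sat Q E e q)"
| "sat Q E e (FAll p) = (\<forall>a. sat Q E (case_nat a e) p)"

lemma sat_ren: "sat Q E e (ren f p) = sat Q E (\<lambda>i. e (f i)) p"
proof (induction p arbitrary: e f)
  case (FAll p)
  have "(\<lambda>i. case_nat a e (case_nat 0 (\<lambda>i. Suc (f i)) i)) = case_nat a (\<lambda>i. e (f i))" for a
    by (auto simp: fun_eq_iff split: nat.split)
  then show ?case by (simp add: FAll.IH)
qed auto

text \<open>Passes from a model whose equality is a congruence to its quotient. Surjectivity of
  \<open>h\<close> makes the quantifiers of both sides range over the same classes.\<close>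

lemma sat_quotient:
  assumes "\<And>a b. E' (h a) (h b) = E a b" "\<And>a b. h a = h b \<longleftrightarrow> Q a b" "surj h"
  shows "sat (=) E' (\<lambda>i. h (e i)) p = sat Q E e p"
proof (induction p arbitrary: e)
  case (FAll p)
  have "(\<lambda>i. h (case_nat a e i)) = case_nat (h a) (\<lambda>i. h (e i))" for a
    by (auto simp: fun_eq_iff split: nat.split)
  then have "sat (=) E' (case_nat (h a) (\<lambda>i. h (e i))) p = sat Q E (case_nat a e) p" for a
    using FAll.IH[of "case_nat a e"] by simp
  then show ?case using \<open>surj h\<close> by (simp, metis surjD)
qed (simp_all add: assms)

definition congruence :: "('a \<Rightarrow> 'a \<Rightarrow> bool) \<Rightarrow> ('a \<Rightarrow> 'a \<Rightarrow> bool) \<Rightarrow> bool" where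
  "congruence Q E \<longleftrightarrow> equivp Q \<and> (\<forall>a a' b b'. Q a a' \<longrightarrow> Q b b' \<longrightarrow> E a b \<longrightarrow> E a' b')"

text \<open>The elements of the model are the variables themselves, and truth is membership in a
  Henkin extension of \<open>T\<close> with the negation of \<open>r\<close>.\<close>

lemma term_model:
  assumes T: "\<forall>p\<in>T. fbound p = 0" and "fbound r = 0" "\<not> T \<turnstile> r"
  obtains Q E :: "nat \<Rightarrow> nat \<Rightarrow> bool" where "congruence Q E"
    "\<And>p e. p \<in> T \<Longrightarrow> sat Q E e p" "\<And>e. \<not> sat Q E e r"
proof -
  have "consistent (insert (FNeg r) T)"
    using assms(3) proves.Contr unfolding consistent_def by blast
  then obtain H where H: "insert (FNeg r) T \<subseteq> H" "consistent H"
      "\<And>p. p \<in> H \<or> \<not> consistent (insert p H)"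
      "\<And>q. FNeg (FAll q) \<in> H \<Longrightarrow> \<exists>y. FNeg (inst y q) \<in> H"
    using henkin_extension[OF T] by blast
  have closed: "p \<in> H" if "H \<turnstile> p" for p
  proof (rule ccontr)
    assume "p \<notin> H"
    then have "H \<turnstile> FNeg p" using H(3) ImpI_inconsistent by blast
    with that H(2) show False unfolding consistent_def using proves.ImpE by blast
  qed
  have bot: "FBot \<notin> H" using H(2) proves.Assm unfolding consistent_def by blast
  have mp: "q \<in> H" if "FImp p q \<in> H" "p \<in> H" for p q
    using that closed proves.ImpE proves.Assm by blast
  have neg: "FNeg p \<in> H \<longleftrightarrow> p \<notin> H" for p
    using H(3)[of p] ImpI_inconsistent closed mp bot by blast
  have imp: "FImp p q \<in> H \<longleftrightarrow> (p \<in> H \<longrightarrow> q \<in> H)" for p q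
  proof
    assume "p \<in> H \<longrightarrow> q \<in> H"
    then consider "FNeg p \<in> H" | "q \<in> H" using neg by blast
    then have "insert p H \<turnstile> q"
    proof cases
      case 1
      then have "insert p H \<turnstile> FBot" using proves.ImpE[OF proves.Assm proves.Assm] by blast
      then show ?thesis by (intro proves.Contr[of q]) (auto elim!: weaken)
    qed (simp add: proves.Assm)
    then show "FImp p q \<in> H" using closed proves.ImpI by blast
  qed (use mp in blast)
  have all: "FAll q \<in> H \<longleftrightarrow> (\<forall>x. inst x q \<in> H)" for q
    using closed proves.AllE proves.Assm neg H(4) by metis
  define Q where "Q x y \<longleftrightarrow> FEq x y \<in> H" for x y
  define E where "E x y \<longleftrightarrow> FMem x y \<in> H" for x y
  \<comment> \<open>Truth lemma. An environment is here a map from variables to variables, so it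
    acts as a renaming; the quantifier case combines \<open>all\<close> with
    \<open>inst_ren\<close>.\<close>
  have sat: "sat Q E f p \<longleftrightarrow> ren f p \<in> H" for f p
    by (induction p arbitrary: f) (simp_all add: Q_def E_def bot imp all inst_ren)
  have ren: "ren f p = p" if "fbound p = 0" for f p
    using ren_cong[of p f "\<lambda>i. i"] that by (simp add: ren_id)
  \<comment> \<open>The congruence laws are instances of this at atomic formulas in which 0 is the
    replaced variable. The other variable carries a \<open>Suc\<close>, which instantiation
    removes.\<close>
  have subst: "inst y p \<in> H" if "Q x y" "inst x p \<in> H" for x y p
    using that closed proves.EqE proves.Assm unfolding Q_def by blast
  have refl: "Q x x" for x using closed proves.EqI unfolding Q_def by blast
  have sym: "Q y x" if "Q x y" for x y
    using subst[of x y "FEq 0 (Suc x)"] that refl by (simp add: inst_def Q_def)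
  have trans: "Q x z" if "Q x y" "Q y z" for x y z
    using subst[of y z "FEq (Suc x) 0"] that by (simp add: inst_def Q_def)
  have l: "E y z" if "Q x y" "E x z" for x y z
    using subst[of x y "FMem 0 (Suc z)"] that by (simp add: inst_def E_def)
  have r: "E z y" if "Q x y" "E z x" for x y z
    using subst[of x y "FMem (Suc z) 0"] that by (simp add: inst_def E_def)
  show thesis
  proof
    show "congruence Q E"
      unfolding congruence_def
    proof (intro conjI allI impI)
      show "equivp Q"
        by (intro equivpI reflpI sympI transpI) (fact refl, fact sym, fact trans)
      show "E a' b'" if "Q a a'" "Q b b'" "E a b" for a a' b b'
        using l[OF that(1)] r[OF that(2)] that(3) by blast
    qed
    show "sat Q E e p" if "p \<in> T" for p e
      using that H(1) T by (auto simp: sat ren)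
    show "\<not> sat Q E e r" for e
      using assms(2) H(1) neg by (auto simp: sat ren)
  qed
qed

text \<open>A hypothesis cannot range over models of all types, so models are fixed on
  \<open>nat\<close>. By \<open>infinite\<close> the term model has infinitely many classes;
  numbering them by all natural numbers gives a model with true equality, to which
  \<open>valid\<close> applies.\<close>

theorem completeness:
  assumes T: "\<forall>p\<in>T. fbound p = 0" and r: "fbound r = 0"
    and infinite: "\<And>Q E :: nat \<Rightarrow> nat \<Rightarrow> bool. congruence Q E \<Longrightarrow> (\<forall>p\<in>T. \<forall>e. sat Q E e p) \<Longrightarrow>
      \<nexists>F. finite F \<and> (\<forall>a. \<exists>b\<in>F. Q a b)"
    and valid: "\<And>(E :: nat \<Rightarrow> nat \<Rightarrow> bool) e. (\<forall>p\<in>T. \<forall>e. sat (=) E e p) \<Longrightarrow> sat (=) E e r"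
  shows "T \<turnstile> r"
proof (rule ccontr)
  assume "\<not> T \<turnstile> r"
  then obtain Q E :: "nat \<Rightarrow> nat \<Rightarrow> bool" where Q: "congruence Q E"
      and T': "\<And>p e. p \<in> T \<Longrightarrow> sat Q E e p" and r': "\<And>e. \<not> sat Q E e r"
    using term_model T r by metis
  have eq: "equivp Q" using Q by (simp add: congruence_def)
  \<comment> \<open>Least elements serve as canonical representatives of the classes of
    \<open>Q\<close>.\<close>
  define g where "g x = (LEAST y. Q x y)" for x
  have g: "Q x (g x)" for x
    unfolding g_def by (rule LeastI[of _ x]) (use eq in \<open>simp add: equivp_reflp\<close>)
  have g_eq: "g x = g y \<longleftrightarrow> Q x y" for x y
  proof
    assume "g x = g y"
    then show "Q x y" using g[of x] g[of y] eq by (metis equivp_symp equivp_transp)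
  next
    assume "Q x y"
    then have "Q x = Q y" using eq by (simp add: equivp_def)
    then show "g x = g y" by (simp add: g_def)
  qed
  have "infinite (range g)"
    using infinite[OF Q] T' g by blast
  then obtain k where k: "bij_betw k (range g) (UNIV :: nat set)"
    using bij_enumerate bij_betw_inv by blast
  define h where "h x = k (g x)" for x
  define E' where "E' x y = E (inv h x) (inv h y)" for x y
  have h_eq: "h a = h b \<longleftrightarrow> Q a b" for a b
    unfolding h_def g_eq[symmetric] using k by (auto simp: bij_betw_def inj_on_def)
  have surj: "surj h"
    using k unfolding h_def bij_betw_def by (metis image_image)
  have "Q a (inv h (h a))" for a
    using surj h_eq by (metis surj_f_inv_f)
  then have "E' (h a) (h b) = E a b" for a b
    using Q unfolding E'_def congruence_def by (meson equivp_symp)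
  note sat = sat_quotient[of E' h, OF this h_eq surj]
  \<comment> \<open>As \<open>h\<close> is surjective, every environment of the quotient lifts along
    \<open>inv h\<close> to one of the term model.\<close>
  have "sat (=) E' (h \<circ> (inv h \<circ> e)) p = sat Q E (inv h \<circ> e) p" for e p
    using sat[of "inv h \<circ> e"] by (simp add: comp_def)
  then have "sat (=) E' e p = sat Q E (inv h \<circ> e) p" for e p
    using surj by (simp add: comp_def surj_f_inv_f)
  then show False using valid[of E'] T' r' by simp
qed

section \<open>Semantics of formulas written with levels\<close>

abbreviation scons :: "'a \<Rightarrow> (nat \<Rightarrow> 'a) \<Rightarrow> nat \<Rightarrow> 'a" (infixr "\<rhd>" 65) where
  "a \<rhd> e \<equiv> case_nat a e"

lemma sat_cong: "(\<And>i. i < fbound p \<Longrightarrow> e i = e' i) \<Longrightarrow> sat Q E e p = sat Q E e' p"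
proof (induction p arbitrary: e e')
  case (FImp p q)
  have "sat Q E e p = sat Q E e' p" by (rule FImp.IH(1)) (simp add: FImp.prems)
  moreover have "sat Q E e q = sat Q E e' q" by (rule FImp.IH(2)) (simp add: FImp.prems)
  ultimately show ?case by simp
next
  case (FAll p)
  have "sat Q E (a \<rhd> e) p = sat Q E (a \<rhd> e') p" for a
    by (rule FAll.IH) (use FAll.prems in \<open>auto split: nat.split\<close>)
  then show ?case by simp
qed auto

lemma sat_FAll_funpow:
  "sat Q E e ((FAll ^^ n) p) \<longleftrightarrow> (\<forall>e'. (\<forall>i. e' (n + i) = e i) \<longrightarrow> sat Q E e' p)"
proof (induction n arbitrary: e)
  case 0
  have "(\<forall>i. e' i = e i) \<longleftrightarrow> e' = e" for e' by (simp add: fun_eq_iff)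
  then show ?case by simp
next
  case (Suc n)
  have *: "(\<exists>a. \<forall>i. e' (n + i) = (a \<rhd> e) i) \<longleftrightarrow> (\<forall>i. e' (Suc n + i) = e i)" for e'
  proof
    assume "\<forall>i. e' (Suc n + i) = e i"
    then have "\<forall>i. e' (n + i) = (e' n \<rhd> e) i" by (auto split: nat.split)
    then show "\<exists>a. \<forall>i. e' (n + i) = (a \<rhd> e) i" ..
  next
    assume "\<exists>a. \<forall>i. e' (n + i) = (a \<rhd> e) i"
    then obtain a where "\<And>i. e' (n + i) = (a \<rhd> e) i" by blast
    from this[of "Suc i" for i] show "\<forall>i. e' (Suc n + i) = e i" by simp
  qed
  have "sat Q E e ((FAll ^^ Suc n) p) \<longleftrightarrow>
      (\<forall>e'. (\<exists>a. \<forall>i. e' (n + i) = (a \<rhd> e) i) \<longrightarrow> sat Q E e' p)"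
    using Suc.IH by (simp, blast)
  then show ?case by (simp only: *)
qed

lemma sat_ucl: "sat Q E e (ucl p) \<longleftrightarrow> (\<forall>e. sat Q E e p)"
proof
  assume *: "sat Q E e (ucl p)"
  show "\<forall>e. sat Q E e p"
  proof
    fix e'
    \<comment> \<open>The closure fixes the environment only beyond \<open>fbound p\<close>, so the
      free variables may be given the values of \<open>e'\<close>.\<close>
    let ?e = "\<lambda>i. if i < fbound p then e' i else e (i - fbound p)"
    have "sat Q E ?e p" using * by (simp add: ucl_def sat_FAll_funpow)
    then show "sat Q E e' p" using sat_cong[of p e' ?e] by simp
  qed
qed (simp add: ucl_def sat_FAll_funpow)

text \<open>Keeping \<open>P d\<close> folded under a constant lets simplification follow the
  connectives of the level notation instead of the de Bruijn term.\<close>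

definition tru :: "('a \<Rightarrow> 'a \<Rightarrow> bool) \<Rightarrow> ('a \<Rightarrow> 'a \<Rightarrow> bool) \<Rightarrow> (nat \<Rightarrow> 'a) \<Rightarrow> nat \<Rightarrow> frm \<Rightarrow> bool" where
  "tru Q E e d P \<longleftrightarrow> sat Q E e (P d)"

definition val :: "(nat \<Rightarrow> 'a) \<Rightarrow> nat \<Rightarrow> nat \<Rightarrow> 'a" where
  "val e d x = e (d - Suc x)"

text \<open>The values of the parameters: below \<open>d\<close> quantifiers the first
  \<open>d\<close> entries belong to the bound variables, and \<open>app\<close> leaves the
  parameters behind them.\<close>

definition shift :: "nat \<Rightarrow> (nat \<Rightarrow> 'a) \<Rightarrow> nat \<Rightarrow> 'a" where
  "shift d e = (\<lambda>i. e (d + i))"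

text \<open>The newly bound variable has level \<open>d\<close>, and older levels keep their values.
  The condition that a level is below the depth recurs for this reason in all later truth
  lemmas.\<close>

lemma val_scons [simp]:
  "val (a \<rhd> e) (Suc d) d = a" "x < d \<Longrightarrow> val (a \<rhd> e) (Suc d) x = val e d x"
  by (simp_all add: val_def Suc_diff_Suc[symmetric] del: diff_Suc_Suc)

lemma shift_scons [simp]: "shift (Suc d) (a \<rhd> e) = shift d e" "shift 0 e = e"
  by (simp_all add: shift_def)

lemma tru_simps [simp]:
  "tru Q E e d (x \<^bold>\<in> y) \<longleftrightarrow> E (val e d x) (val e d y)"
  "tru Q E e d (x \<^bold>= y) \<longleftrightarrow> Q (val e d x) (val e d y)"
  "tru Q E e d (\<^bold>\<not> A) \<longleftrightarrow> \<not> tru Q E e d A"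
  "tru Q E e d (A \<^bold>\<and> B) \<longleftrightarrow> tru Q E e d A \<and> tru Q E e d B"
  "tru Q E e d (A \<^bold>\<or> B) \<longleftrightarrow> tru Q E e d A \<or> tru Q E e d B"
  "tru Q E e d (A \<^bold>\<longrightarrow> B) \<longleftrightarrow> (tru Q E e d A \<longrightarrow> tru Q E e d B)"
  "tru Q E e d (A \<^bold>\<longleftrightarrow> B) \<longleftrightarrow> (tru Q E e d A \<longleftrightarrow> tru Q E e d B)"
  "tru Q E e d (all P) \<longleftrightarrow> (\<forall>a. tru Q E (a \<rhd> e) (Suc d) (P d))"
  "tru Q E e d (ex P) \<longleftrightarrow> (\<exists>a. tru Q E (a \<rhd> e) (Suc d) (P d))"
  by (auto simp: tru_def val_def mem_def equ_def neg_def con_def dis_def imp_def iff_def all_def ex_def)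

lemma tru_app [simp]:
  "tru Q E e d (app p [x]) \<longleftrightarrow> sat Q E (val e d x \<rhd> shift d e) p"
  "tru Q E e d (app p [x, y]) \<longleftrightarrow> sat Q E (val e d x \<rhd> val e d y \<rhd> shift d e) p"
  unfolding tru_def app_def sat_ren
  by (rule arg_cong[of _ _ "\<lambda>e. sat Q E e p"],
      force simp: fun_eq_iff val_def shift_def nth_Cons split: nat.split)+

lemma sat_sentence: "sat Q E e (sentence P) \<longleftrightarrow> (\<forall>e. tru Q E e 0 P)"
  by (simp add: sentence_def sat_ucl tru_def)

text \<open>
  A finite model would have a universal set, contradicting Russell's paradox. Infinity lets the
  quotient of the term model be transported to the type of natural numbers.
\<close>

lemma no_finite_model:
  assumes Q: "congruence Q E" and T: "\<forall>p\<in>EST. \<forall>e. sat Q E e p"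
  shows "\<nexists>F. finite F \<and> (\<forall>a. \<exists>b\<in>F. Q a b)"
proof
  assume "\<exists>F. finite F \<and> (\<forall>a. \<exists>b\<in>F. Q a b)"
  then obtain F where F: "finite F" "\<And>a. \<exists>b\<in>F. Q a b" by blast
  have refl: "Q x x" for x using Q by (simp add: congruence_def equivp_reflp)
  have cong: "Q a a' \<Longrightarrow> Q b b' \<Longrightarrow> E a b \<Longrightarrow> E a' b'" for a a' b b'
    using Q unfolding congruence_def by blast
  have sym: "Q x y \<Longrightarrow> Q y x" for x y using Q unfolding congruence_def by (blast dest: equivp_symp)
  have pair: "\<exists>z. \<forall>w. E w z \<longleftrightarrow> Q w x \<or> Q w y" for x y
  proof -
    have "sat Q E e Pairing" for e using T by (simp add: EST_def)
    then show ?thesis by (simp add: Pairing_def sat_sentence UPair_def)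
  qed
  have union: "\<exists>z. \<forall>w. E w z \<longleftrightarrow> (\<exists>y. E y x \<and> E w y)" for x
  proof -
    have "sat Q E e Union_Ax" for e using T by (simp add: EST_def)
    then show ?thesis by (simp add: Union_Ax_def sat_sentence Union_def)
  qed
  have sep: "\<exists>b. \<forall>x. E x b \<longleftrightarrow> E x a \<and> \<not> E x x" for a
  proof -
    \<comment> \<open>Russell's formula, which is quantifier-free and so a legitimate instance of
      separation.\<close>
    have "delta0 (FNeg (FMem 0 0))" by (intro delta0.intros)
    then have "sat Q E e (separation (FNeg (FMem 0 0)))" for e using T unfolding EST_def by blast
    then show ?thesis by (simp add: separation_def sat_sentence)
  qed
  have "\<exists>s. \<forall>a\<in>F. E a s"
    using F(1)
  proof induction
    case (insert a F)
    then obtain s where s: "\<forall>a\<in>F. E a s" by blast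
    obtain u where u: "\<And>w. E w u \<longleftrightarrow> Q w a \<or> Q w a" using pair by blast
    obtain v where v: "\<And>w. E w v \<longleftrightarrow> Q w s \<or> Q w u" using pair by blast
    obtain t where t: "\<And>w. E w t \<longleftrightarrow> (\<exists>y. E y v \<and> E w y)" using union by blast
    have "\<forall>b\<in>insert a F. E b t" using s u v t refl by blast
    then show ?case ..
  qed simp
  \<comment> \<open>Pairing and union have collected one representative of each class into
    \<open>s\<close>; by congruence \<open>s\<close> then contains everything.\<close>
  then obtain s where s: "\<And>a. E a s" using F(2) cong refl sym by meson
  then show False using sep[of s] by blast
qed

section \<open>Models of elementary set theory\<close>

locale set_model =
  fixes E :: "'a \<Rightarrow> 'a \<Rightarrow> bool" (infix "\<epsilon>" 50)
  assumes EST: "p \<in> EST \<Longrightarrow> sat (=) E e p"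
begin

abbreviation tr :: "(nat \<Rightarrow> 'a) \<Rightarrow> nat \<Rightarrow> frm \<Rightarrow> bool" where
  "tr \<equiv> tru (=) E"

lemma extensional: "(\<And>w. w \<epsilon> x \<longleftrightarrow> w \<epsilon> y) \<Longrightarrow> x = y"
proof -
  have "sat (=) E e Extensionality" for e using EST by (simp add: EST_def)
  then show "(\<And>w. w \<epsilon> x \<longleftrightarrow> w \<epsilon> y) \<Longrightarrow> x = y" by (simp add: Extensionality_def sat_sentence)
qed

text \<open>Extensionality turns a defining formula into an equation with a term, so that the
  operations below can be used as rewrite targets for object-level formulas.\<close>

lemma eq_the_set: "\<exists>z. \<forall>w. w \<epsilon> z \<longleftrightarrow> P w \<Longrightarrow> x = (THE z. \<forall>w. w \<epsilon> z \<longleftrightarrow> P w) \<longleftrightarrow> (\<forall>w. w \<epsilon> x \<longleftrightarrow> P w)"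
proof -
  assume "\<exists>z. \<forall>w. w \<epsilon> z \<longleftrightarrow> P w"
  then have ex1: "\<exists>!z. \<forall>w. w \<epsilon> z \<longleftrightarrow> P w" using extensional by blast
  show ?thesis
    using theI'[OF ex1] the1_equality[OF ex1] by blast
qed

definition emp :: 'a where "emp = (THE z. \<forall>w. w \<epsilon> z \<longleftrightarrow> False)"

definition up :: "'a \<Rightarrow> 'a \<Rightarrow> 'a" where "up x y = (THE z. \<forall>w. w \<epsilon> z \<longleftrightarrow> w = x \<or> w = y)"

text \<open>The Kuratowski pair, matching \<open>OPair\<close>.\<close>

definition pr :: "'a \<Rightarrow> 'a \<Rightarrow> 'a" where "pr x y = up (up x x) (up x y)"

definition un :: "'a \<Rightarrow> 'a" where "un x = (THE z. \<forall>w. w \<epsilon> z \<longleftrightarrow> (\<exists>y. y \<epsilon> x \<and> w \<epsilon> y))"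

definition suc :: "'a \<Rightarrow> 'a" where "suc x = un (up x (up x x))"

definition cross :: "'a \<Rightarrow> 'a \<Rightarrow> 'a" where
  "cross x y = (THE z. \<forall>w. w \<epsilon> z \<longleftrightarrow> (\<exists>a b. a \<epsilon> x \<and> b \<epsilon> y \<and> w = pr a b))"

lemma eq_emp: "x = emp \<longleftrightarrow> (\<forall>w. \<not> w \<epsilon> x)"
proof -
  have "sat (=) E e Empty_Set" for e using EST by (simp add: EST_def)
  then have "\<exists>z. \<forall>w. w \<epsilon> z \<longleftrightarrow> False" by (simp add: Empty_Set_def sat_sentence Empty_def)
  from eq_the_set[OF this] show ?thesis by (simp add: emp_def)
qed

lemma mem_emp [simp]: "\<not> w \<epsilon> emp"
  using eq_emp by blast

lemma eq_up: "z = up x y \<longleftrightarrow> (\<forall>w. w \<epsilon> z \<longleftrightarrow> w = x \<or> w = y)"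
proof -
  have "sat (=) E e Pairing" for e using EST by (simp add: EST_def)
  then have "\<exists>z. \<forall>w. w \<epsilon> z \<longleftrightarrow> w = x \<or> w = y" by (simp add: Pairing_def sat_sentence UPair_def)
  from eq_the_set[OF this] show ?thesis by (simp add: up_def)
qed

lemma mem_up [simp]: "w \<epsilon> up x y \<longleftrightarrow> w = x \<or> w = y"
  using eq_up by blast

lemma up_inject: "up x y = up u v \<longleftrightarrow> x = u \<and> y = v \<or> x = v \<and> y = u"
proof
  assume "up x y = up u v"
  then have "w = x \<or> w = y \<longleftrightarrow> w = u \<or> w = v" for w by (simp flip: mem_up)
  from this[of x] this[of y] this[of u] this[of v] show "x = u \<and> y = v \<or> x = v \<and> y = u" by auto
qed (auto simp: eq_up)

lemma pr_inject [simp]: "pr x y = pr u v \<longleftrightarrow> x = u \<and> y = v"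
  by (auto simp: pr_def up_inject)

lemma eq_un: "z = un x \<longleftrightarrow> (\<forall>w. w \<epsilon> z \<longleftrightarrow> (\<exists>y. y \<epsilon> x \<and> w \<epsilon> y))"
proof -
  have "sat (=) E e Union_Ax" for e using EST by (simp add: EST_def)
  then have "\<exists>z. \<forall>w. w \<epsilon> z \<longleftrightarrow> (\<exists>y. y \<epsilon> x \<and> w \<epsilon> y)"
    by (simp add: Union_Ax_def sat_sentence Union_def)
  from eq_the_set[OF this] show ?thesis by (simp add: un_def)
qed

lemma mem_un: "w \<epsilon> un x \<longleftrightarrow> (\<exists>y. y \<epsilon> x \<and> w \<epsilon> y)"
  using eq_un by blast

lemma mem_suc [simp]: "w \<epsilon> suc x \<longleftrightarrow> w \<epsilon> x \<or> w = x"
  by (auto simp: suc_def mem_un)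

lemma eq_suc: "z = suc x \<longleftrightarrow> (\<forall>w. w \<epsilon> z \<longleftrightarrow> w \<epsilon> x \<or> w = x)"
  using extensional[of z "suc x"] by auto

lemma tr_basic [simp]:
  "x < d \<Longrightarrow> tr e d (Empty x) \<longleftrightarrow> val e d x = emp"
  "z < d \<Longrightarrow> x < d \<Longrightarrow> y < d \<Longrightarrow> tr e d (UPair z x y) \<longleftrightarrow> val e d z = up (val e d x) (val e d y)"
  "x < d \<Longrightarrow> y < d \<Longrightarrow> tr e d (Subset x y) \<longleftrightarrow> (\<forall>z. z \<epsilon> val e d x \<longrightarrow> z \<epsilon> val e d y)"
  "y < d \<Longrightarrow> x < d \<Longrightarrow> tr e d (Succ y x) \<longleftrightarrow> val e d y = suc (val e d x)"
  by (simp_all add: Empty_def eq_emp UPair_def eq_up Subset_def Succ_def eq_suc)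

lemma tr_OPair [simp]:
  "z < d \<Longrightarrow> x < d \<Longrightarrow> y < d \<Longrightarrow> tr e d (OPair z x y) \<longleftrightarrow> val e d z = pr (val e d x) (val e d y)"
  by (simp add: OPair_def less_SucI pr_def)

lemma mem_cross [simp]: "w \<epsilon> cross x y \<longleftrightarrow> (\<exists>a b. a \<epsilon> x \<and> b \<epsilon> y \<and> w = pr a b)"
proof -
  have "sat (=) E e Cartesian_Product" for e using EST by (simp add: EST_def)
  then have "\<exists>z. \<forall>w. w \<epsilon> z \<longleftrightarrow> (\<exists>a b. a \<epsilon> x \<and> b \<epsilon> y \<and> w = pr a b)"
    by (simp add: Cartesian_Product_def sat_sentence Product_def)
  from eq_the_set[OF this] show ?thesis by (metis cross_def)
qed

lemma tr_Product [simp]: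
  "z < d \<Longrightarrow> x < d \<Longrightarrow> y < d \<Longrightarrow> tr e d (Product z x y) \<longleftrightarrow> val e d z = cross (val e d x) (val e d y)"
  using extensional[of "val e d z" "cross (val e d x) (val e d y)"] by (auto simp: Product_def less_SucI)

section \<open>Functions, numerals, codes and structures in the model\<close>

definition fun_on :: "'a \<Rightarrow> 'a \<Rightarrow> bool" where
  "fun_on f a \<longleftrightarrow> (\<forall>z. z \<epsilon> f \<longrightarrow> (\<exists>x y. x \<epsilon> a \<and> z = pr x y)) \<and>
    (\<forall>x. x \<epsilon> a \<longrightarrow> (\<exists>y. pr x y \<epsilon> f)) \<and> (\<forall>x y z. pr x y \<epsilon> f \<and> pr x z \<epsilon> f \<longrightarrow> y = z)"

definition func :: "'a \<Rightarrow> 'a \<Rightarrow> 'a \<Rightarrow> bool" where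
  "func f a b \<longleftrightarrow> fun_on f a \<and> (\<forall>x y. pr x y \<epsilon> f \<longrightarrow> y \<epsilon> b)"

primrec num :: "nat \<Rightarrow> 'a" where
  "num 0 = emp"
| "num (Suc n) = suc (num n)"

text \<open>Separates the tag of \<open>U\<close> from the tags of the other formulas. The numeral 1
  has \<open>emp\<close> as its only element, whereas every numeral from 2 on has an inhabited
  element.\<close>

lemma num_eq_1: "num n = num (Suc 0) \<longleftrightarrow> n = Suc 0"
proof -
  consider "n = 0" | "n = Suc 0" | m where "n = Suc (Suc m)" by (metis not0_implies_Suc)
  then show ?thesis
  proof cases
    case 1
    have "emp \<epsilon> suc emp" by simp
    then have "emp \<noteq> suc emp" by force
    with 1 show ?thesis by simp
  next
    case 3
    have "suc (num m) \<epsilon> num n" "num m \<epsilon> suc (num m)" using 3 by simp_all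
    then have "num n \<noteq> num (Suc 0)" by force
    with 3 show ?thesis by simp
  qed simp
qed

lemma tr_functions [simp]:
  "f < d \<Longrightarrow> x < d \<Longrightarrow> y < d \<Longrightarrow> tr e d (Maps_to f x y) \<longleftrightarrow> pr (val e d x) (val e d y) \<epsilon> val e d f"
  "f < d \<Longrightarrow> a < d \<Longrightarrow> tr e d (Function_on f a) \<longleftrightarrow> fun_on (val e d f) (val e d a)"
  "f < d \<Longrightarrow> a < d \<Longrightarrow> b < d \<Longrightarrow> tr e d (Function f a b) \<longleftrightarrow> func (val e d f) (val e d a) (val e d b)"
  by (simp_all add: Maps_to_def Function_on_def Function_def fun_on_def func_def less_SucI)

lemma tr_Numeral [simp]: "x < d \<Longrightarrow> tr e d (Numeral n x) \<longleftrightarrow> val e d x = num n"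
  by (induction n arbitrary: x e d) (auto simp: less_SucI)

lemma tr_Tag [simp]:
  "z < d \<Longrightarrow> x < d \<Longrightarrow> tr e d (Tag n z x) \<longleftrightarrow> val e d z = pr (num n) (val e d x)"
  "z < d \<Longrightarrow> x < d \<Longrightarrow> y < d \<Longrightarrow> tr e d (Tag2 n z x y) \<longleftrightarrow> val e d z = pr (num n) (pr (val e d x) (val e d y))"
  by (simp_all add: Tag_def Tag2_def less_SucI)

lemma tr_Structure [simp]:
  "A < d \<Longrightarrow> S < d \<Longrightarrow> M < d \<Longrightarrow> U < d \<Longrightarrow> R < d \<Longrightarrow> I < d \<Longrightarrow>
   tr e d (Structure True False A S M U R I) \<longleftrightarrow>
    val e d S = pr (pr (val e d M) (val e d U)) (val e d I) \<and> val e d R = emp \<and>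
    (\<forall>z. z \<epsilon> val e d U \<longrightarrow> z \<epsilon> val e d M) \<and> func (val e d I) (val e d A) (val e d M)"
  by (auto simp: Structure_def less_SucI)

section \<open>Satisfaction of an atomic sentence without variables\<close>

lemma tr_Nat_emp: "x < d \<Longrightarrow> val e d x = emp \<Longrightarrow> tr e d (Nat x)"
  by (simp add: Nat_def Ord_def LinOrd_def less_SucI)

lemma fun_on_emp [simp]: "fun_on f emp \<longleftrightarrow> f = emp"
  by (auto simp: fun_on_def eq_emp)

lemma func_emp [simp]: "func f emp M \<longleftrightarrow> f = emp"
  by (auto simp: func_def)

abbreviation sing :: "'a \<Rightarrow> 'a" where "sing x \<equiv> up x x"

lemma fun_on_sing: "fun_on (sing (pr emp x)) (suc emp)"
  by (simp add: fun_on_def)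

text \<open>With \<open>k = 0\<close> variables the only assignment is the empty one and its tuple
  is \<open>emp\<close>; the sequence \<open>w\<close> building it is the single pair of
  \<open>emp\<close> with itself.\<close>

lemma tr_Tuple_emp:
  assumes "k < d" "s < d" "t < d" "val e d k = emp"
  shows "tr e d (Tuple k s t) \<longleftrightarrow> val e d t = emp"
proof -
  have "tr e d (Tuple k s t) \<longleftrightarrow> (\<exists>w. fun_on w (suc emp) \<and> pr emp emp \<epsilon> w \<and> pr emp (val e d t) \<epsilon> w)"
    using assms by (simp add: Tuple_def less_SucI)
  also have "\<dots> \<longleftrightarrow> val e d t = emp"
  proof
    assume "val e d t = emp"
    then show "\<exists>w. fun_on w (suc emp) \<and> pr emp emp \<epsilon> w \<and> pr emp (val e d t) \<epsilon> w"
      by (intro exI[of _ "sing (pr emp emp)"]) (simp add: fun_on_sing)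
  qed (auto simp: fun_on_def)
  finally show ?thesis .
qed

lemma tr_Holds_emp:
  assumes "k < d" "h < d" "i < d" "s < d" "val e d k = emp"
  shows "tr e d (Holds k h i s) \<longleftrightarrow> (\<exists>H. pr (val e d i) H \<epsilon> val e d h \<and> emp \<epsilon> H)"
  using assms by (simp add: Holds_def less_SucI tr_Tuple_emp)

text \<open>The code of the sentence \<open>U(c\<^sub>c)\<close>, the only formula to which elementarity is applied.\<close>

definition U_const :: "'a \<Rightarrow> 'a" where "U_const c = pr (num 1) (pr (num 1) c)"

lemma tr_Atom_U_const:
  assumes "A < d" "k < d" "z < d" "c \<epsilon> val e d A" "val e d z = U_const c"
  shows "tr e d (Atom True False A k z)"
  unfolding Defs.Atom_def Let_def
  using assms by (simp add: less_SucI Term_def U_const_def del: num.simps)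

lemma tr_Formation_U_const:
  assumes "A < d" "k < d" "N < d" "g < d" "val e d k = emp" "val e d N = emp" "c \<epsilon> val e d A"
    and "val e d g = sing (pr emp (U_const c))"
  shows "tr e d (Formation True False A k N g)"
  using assms
  by (simp add: Formation_def less_SucI tr_Nat_emp fun_on_sing tr_Atom_U_const)

lemma tr_Formula_U_const:
  assumes "A < d" "k < d" "p < d" "val e d k = emp" "c \<epsilon> val e d A" "val e d p = U_const c"
  shows "tr e d (Formula True False A k p)"
proof -
  let ?g = "sing (pr emp (U_const c))"
  have "tr (?g \<rhd> emp \<rhd> e) (Suc (Suc d)) (Formation True False A k d (Suc d))"
    using assms by (intro tr_Formation_U_const[where c = c]) (simp_all add: less_SucI)
  then show ?thesis
    unfolding Formula_def tru_simps
    by (rule_tac exI[of _ emp], rule_tac exI[of _ ?g]) (use assms in \<open>simp add: less_SucI\<close>)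
qed

text \<open>\<open>Satisfies\<close> is existential, so an explicit evaluation is constructed for a
  true sentence. Along the one-term formation sequence, \<open>h\<close> assigns to index 0 the set
  containing just the empty tuple, which stands for truth.\<close>

lemma tr_Evaluation_U_const:
  assumes "M < d" "U < d" "R < d" "I < d" "k < d" "N < d" "g < d" "h < d"
    and "val e d k = emp" "val e d N = emp" "pr c a \<epsilon> val e d I" "a \<epsilon> val e d U"
    and "val e d g = sing (pr emp (U_const c))" "val e d h = sing (pr emp (sing emp))"
  shows "tr e d (Evaluation M U R I k N g h)"
  using assms
  by (auto simp: Evaluation_def less_SucI tr_Holds_emp Term_Value_def fun_on_sing U_const_def simp del: num.simps)

text \<open>Here the formation sequence and the evaluation are arbitrary. Among the Tarski clauses
  at \<open>N\<close>, distinct tags leave only the one for \<open>U\<close>, and likewise only the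
  constant case of the term value.\<close>

lemma tr_Evaluation_U_constD:
  assumes "tr e d (Evaluation M U R I k N g h)"
    and "M < d" "U < d" "R < d" "I < d" "k < d" "N < d" "g < d" "h < d" "s < d"
    and "val e d k = emp" "val e d s = emp" "pr (val e d N) (U_const c) \<epsilon> val e d g" "tr e d (Holds k h N s)"
  shows "\<exists>a. pr c a \<epsilon> val e d I \<and> a \<epsilon> val e d U"
  using assms
  by (simp add: Evaluation_def less_SucI tr_Holds_emp Term_Value_def U_const_def
      num_eq_1 num_eq_1[THEN eq_iff_swap] del: num.simps)

lemma tr_Satisfies_U_const:
  assumes "A < d" "M < d" "U < d" "R < d" "I < d" "k < d" "p < d" "s < d"
    and "val e d k = emp" "val e d s = emp" "c \<epsilon> val e d A" "val e d p = U_const c"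
  shows "tr e d (Satisfies True False A M U R I k p s) \<longleftrightarrow>
    (\<exists>a. pr c a \<epsilon> val e d I \<and> a \<epsilon> val e d U)"
proof
  assume "\<exists>a. pr c a \<epsilon> val e d I \<and> a \<epsilon> val e d U"
  then obtain a where a: "pr c a \<epsilon> val e d I" "a \<epsilon> val e d U" by blast
  let ?g = "sing (pr emp (U_const c))" and ?h = "sing (pr emp (sing emp))"
  \<comment> \<open>The bound \<open>N\<close>, \<open>g\<close>, \<open>h\<close> have levels
    \<open>d\<close>, \<open>Suc d\<close>, \<open>Suc (Suc d)\<close>; the innermost stands first
    in the environment.\<close>
  let ?e = "?h \<rhd> ?g \<rhd> emp \<rhd> e" and ?d = "Suc (Suc (Suc d))"
  have "tr ?e ?d (Formation True False A k d (Suc d))"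
    using assms by (intro tr_Formation_U_const[where c = c]) (simp_all add: less_SucI)
  moreover have "tr ?e ?d (Evaluation M U R I k d (Suc d) (Suc (Suc d)))"
    using assms a by (intro tr_Evaluation_U_const[where c = c and a = a]) (simp_all add: less_SucI)
  moreover have "tr ?e ?d (Holds k (Suc (Suc d)) d s)"
    using assms by (simp add: less_SucI tr_Holds_emp)
  ultimately show "tr e d (Satisfies True False A M U R I k p s)"
    unfolding Satisfies_def tru_simps
    by (rule_tac exI[of _ emp], rule_tac exI[of _ ?g], rule_tac exI[of _ ?h])
      (use assms in \<open>simp add: less_SucI\<close>)
next
  assume "tr e d (Satisfies True False A M U R I k p s)"
  then obtain N g h where *: "tr (h \<rhd> g \<rhd> N \<rhd> e) (Suc (Suc (Suc d)))
     (Formation True False A k d (Suc d) \<^bold>\<and> Maps_to (Suc d) d p \<^bold>\<and>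
       Evaluation M U R I k d (Suc d) (Suc (Suc d)) \<^bold>\<and> Holds k (Suc (Suc d)) d s)"
    unfolding Satisfies_def tru_simps by blast
  have "\<exists>a. pr c a \<epsilon> val (h \<rhd> g \<rhd> N \<rhd> e) (Suc (Suc (Suc d))) I \<and>
     a \<epsilon> val (h \<rhd> g \<rhd> N \<rhd> e) (Suc (Suc (Suc d))) U"
    by (rule tr_Evaluation_U_constD[where M = M and R = R and k = k and N = d and g = "Suc d"
          and h = "Suc (Suc d)" and s = s])
      (use * assms in \<open>simp_all add: less_SucI\<close>)
  then show "\<exists>a. pr c a \<epsilon> val e d I \<and> a \<epsilon> val e d U" using assms by (simp add: less_SucI)
qed

lemma elementary_U_constD:
  assumes "tr e d (\<^bold>\<forall>k. \<^bold>\<forall>p. \<^bold>\<forall>s. \<^bold>\<forall>s'.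
      Formula True False A k p \<^bold>\<and> Function s k M \<^bold>\<and> Function s' k M' \<^bold>\<and>
      (\<^bold>\<forall>n. \<^bold>\<forall>a. \<^bold>\<forall>b. Maps_to s n a \<^bold>\<and> Maps_to f a b \<^bold>\<longrightarrow> Maps_to s' n b) \<^bold>\<longrightarrow>
      (Satisfies True False A M U R I k p s \<^bold>\<longleftrightarrow> Satisfies True False A M' U' R' I' k p s'))"
    and "A < d" "M < d" "U < d" "R < d" "I < d" "M' < d" "U' < d" "R' < d" "I' < d" "f < d"
    and "c \<epsilon> val e d A"
  shows "(\<exists>a. pr c a \<epsilon> val e d I \<and> a \<epsilon> val e d U) \<longleftrightarrow> (\<exists>a. pr c a \<epsilon> val e d I' \<and> a \<epsilon> val e d U')"
  \<comment> \<open>The instances come innermost first, as \<open>s'\<close>, \<open>s\<close>,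
    \<open>p\<close>, \<open>k\<close>. Both assignments are empty, so the condition relating them
    through \<open>f\<close> holds vacuously.\<close>
  using assms(1)[unfolded tru_simps(8), rule_format, of emp emp "U_const c" emp] assms(2-)
  by (simp add: less_SucI tr_Formula_U_const[where c = c] tr_Satisfies_U_const[where c = c])

text \<open>By injectivity of pairing, the components quantified inside the formula are the given
  \<open>U\<close>, \<open>I\<close>, \<open>U'\<close>, \<open>I'\<close>.\<close>

lemma tr_Elementary_EmbeddingD:
  assumes "tr e d (Elementary_Embedding True False A S S' f)"
    and "A < d" "S < d" "S' < d" "f < d" "c \<epsilon> val e d A"
    and "val e d S = pr (pr M U) I" "val e d S' = pr (pr M' U') I'"
  shows "(\<exists>a. pr c a \<epsilon> I \<and> a \<epsilon> U) \<longleftrightarrow> (\<exists>a. pr c a \<epsilon> I' \<and> a \<epsilon> U')"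
  using assms(1) unfolding Elementary_Embedding_def tru_simps(4,9)
  by (elim exE conjE, drule_tac elementary_U_constD[where c = c])
    (use assms(2-) in \<open>simp_all add: less_SucI\<close>)

end

section \<open>Bounded formulas\<close>

text \<open>The bound \<open>y < d\<close> makes the index of \<open>y\<close> under the new
  quantifier a successor, as \<open>delta0\<close> demands of a bounding variable.\<close>

lemma delta0_levels:
  "delta0 ((x \<^bold>\<in> y) d)"
  "delta0 ((x \<^bold>= y) d)"
  "delta0 (P d) \<Longrightarrow> delta0 ((\<^bold>\<not> P) d)"
  "delta0 (P d) \<Longrightarrow> delta0 (Q d) \<Longrightarrow> delta0 ((P \<^bold>\<and> Q) d)"
  "delta0 (P d) \<Longrightarrow> delta0 (Q d) \<Longrightarrow> delta0 ((P \<^bold>\<or> Q) d)"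
  "y < d \<Longrightarrow> delta0 (B d (Suc d)) \<Longrightarrow> delta0 ((\<^bold>\<forall>x. x \<^bold>\<in> y \<^bold>\<longrightarrow> B x) d)"
  "y < d \<Longrightarrow> delta0 (B d (Suc d)) \<Longrightarrow> delta0 ((\<^bold>\<exists>x. x \<^bold>\<in> y \<^bold>\<and> B x) d)"
  by (auto simp: mem_def equ_def neg_def con_def dis_def imp_def all_def ex_def Suc_diff_Suc[symmetric]
      simp del: diff_Suc_Suc intro!: delta0.intros)

text \<open>\<open>UPair\<close> and \<open>OPair\<close> use unbounded quantifiers; these
  equivalents are bounded by the members of \<open>z\<close> and so may occur in separation.\<close>

definition UPair0 :: "nat \<Rightarrow> nat \<Rightarrow> nat \<Rightarrow> frm" where
  "UPair0 z x y = (x \<^bold>\<in> z \<^bold>\<and> y \<^bold>\<in> z \<^bold>\<and> (\<^bold>\<forall>w. w \<^bold>\<in> z \<^bold>\<longrightarrow> w \<^bold>= x \<^bold>\<or> w \<^bold>= y))"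

definition OPair0 :: "nat \<Rightarrow> nat \<Rightarrow> nat \<Rightarrow> frm" where
  "OPair0 z x y =
    (\<^bold>\<exists>u. u \<^bold>\<in> z \<^bold>\<and> (\<^bold>\<exists>v. v \<^bold>\<in> z \<^bold>\<and> UPair0 u x x \<^bold>\<and> UPair0 v x y \<^bold>\<and> UPair0 z u v))"

lemma delta0_UPair0: "z < d \<Longrightarrow> delta0 (UPair0 z x y d)"
  unfolding UPair0_def by (intro delta0_levels)

lemma delta0_OPair0: "z < d \<Longrightarrow> delta0 (OPair0 z x y d)"
  unfolding OPair0_def by (intro delta0_levels delta0_UPair0) auto

context set_model
begin

lemma tr_UPair0 [simp]:
  "z < d \<Longrightarrow> x < d \<Longrightarrow> y < d \<Longrightarrow> tr e d (UPair0 z x y) \<longleftrightarrow> val e d z = up (val e d x) (val e d y)"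
  by (auto simp: UPair0_def eq_up less_SucI)

lemma tr_OPair0 [simp]:
  "z < d \<Longrightarrow> x < d \<Longrightarrow> y < d \<Longrightarrow> tr e d (OPair0 z x y) \<longleftrightarrow> val e d z = pr (val e d x) (val e d y)"
  by (auto simp: OPair0_def less_SucI pr_def)

text \<open>In the level notation for positive \<open>d\<close>, the separated variable has level
  \<open>d - 1\<close>, and the lower levels are parameters read from \<open>e\<close>.\<close>

lemma separation_delta0:
  assumes "delta0 (P d)"
  shows "\<exists>b. \<forall>x. x \<epsilon> b \<longleftrightarrow> x \<epsilon> a \<and> tr (x \<rhd> e) d P"
proof -
  have "sat (=) E e (separation (P d))" for e using assms EST unfolding EST_def by blast
  then have "\<forall>e. \<forall>a. \<exists>b. \<forall>x. x \<epsilon> b \<longleftrightarrow> x \<epsilon> a \<and> sat (=) E (x \<rhd> e) (P d)"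
    by (simp add: separation_def sat_sentence)
  then show ?thesis by (simp add: tru_def)
qed

section \<open>Coding the pairs of a functional class by structures\<close>

definition graph :: "'a \<Rightarrow> 'a \<Rightarrow> 'a" where
  "graph a y = (THE z. \<forall>w. w \<epsilon> z \<longleftrightarrow> (\<exists>b. b \<epsilon> a \<and> w = pr b (pr b y)))"

lemma eq_graph: "z = graph a y \<longleftrightarrow> (\<forall>w. w \<epsilon> z \<longleftrightarrow> (\<exists>b. b \<epsilon> a \<and> w = pr b (pr b y)))"
proof -
  let ?M = "cross a (sing y)"
  \<comment> \<open>Levels 0 to 3 are \<open>a\<close>, \<open>?M\<close>, \<open>y\<close> and the
    candidate \<open>w\<close>. The graph is separated from the product of \<open>a\<close> with
    \<open>?M\<close>; the tail of the environment is a filler.\<close>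
  let ?P = "\<^bold>\<exists>b. b \<^bold>\<in> 0 \<^bold>\<and> (\<^bold>\<exists>q. q \<^bold>\<in> Suc 0 \<^bold>\<and> OPair0 q b (Suc (Suc 0)) \<^bold>\<and> OPair0 (Suc (Suc (Suc 0))) b q)"
  have "delta0 (?P (Suc (Suc (Suc (Suc 0)))))" by (intro delta0_levels delta0_OPair0) auto
  from separation_delta0[of ?P, OF this, of "cross a ?M" "y \<rhd> ?M \<rhd> a \<rhd> (\<lambda>_. a)"]
  obtain z where "\<And>w. w \<epsilon> z \<longleftrightarrow> w \<epsilon> cross a ?M \<and>
      tr (w \<rhd> y \<rhd> ?M \<rhd> a \<rhd> (\<lambda>_. a)) (Suc (Suc (Suc (Suc 0)))) ?P" by blast
  then have "\<forall>w. w \<epsilon> z \<longleftrightarrow> (\<exists>b. b \<epsilon> a \<and> w = pr b (pr b y))" by auto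
  then have "\<exists>z. \<forall>w. w \<epsilon> z \<longleftrightarrow> (\<exists>b. b \<epsilon> a \<and> w = pr b (pr b y))" ..
  from eq_the_set[OF this] show ?thesis by (simp add: graph_def)
qed

text \<open>
  The structure \<open>\<langle>a \<times> {y}, {\<langle>x, y\<rangle>}, b \<mapsto> \<langle>b, y\<rangle>\<rangle>\<close>. Tagging the universe with \<open>y\<close> makes \<open>y\<close>
  recoverable from it by a bounded formula, even if \<open>y \<in> a\<close>.
\<close>

definition coding :: "'a \<Rightarrow> 'a \<Rightarrow> 'a \<Rightarrow> 'a" where
  "coding a x y = pr (pr (cross a (sing y)) (sing (pr x y))) (graph a y)"

lemma coding_structure: "func (graph a y) a (cross a (sing y))"
proof -
  have "w \<epsilon> graph a y \<longleftrightarrow> (\<exists>b. b \<epsilon> a \<and> w = pr b (pr b y))" for w using eq_graph by blast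
  then show ?thesis by (auto simp: func_def fun_on_def)
qed

text \<open>Each \<open>y\<close> lies at bounded depth inside its structure, so iterated union
  collects all candidates, and a bounded formula recovers \<open>y\<close> from the unique pair in
  \<open>U\<close>.\<close>

lemma image_from_codings:
  assumes Z: "\<And>S. S \<epsilon> Z \<longleftrightarrow> (\<exists>x y. x \<epsilon> a \<and> F x y \<and> S = coding a x y)"
  shows "\<exists>b. \<forall>y. y \<epsilon> b \<longleftrightarrow> (\<exists>x. x \<epsilon> a \<and> F x y)"
proof -
  \<comment> \<open>Seven unions, for the chain from \<open>y\<close> through \<open>up x y\<close>,
    \<open>pr x y\<close>, \<open>U\<close>, \<open>up M U\<close>, \<open>v\<close>,
    \<open>up v I\<close> and the structure up to \<open>Z\<close>.\<close>
  let ?W = "un (un (un (un (un (un (un Z))))))"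
  \<comment> \<open>Levels 0, 1, 2 are \<open>a\<close>, \<open>Z\<close>, \<open>y\<close>. The
    variables \<open>c\<close> and \<open>q\<close> pass through the unordered pairs inside
    Kuratowski pairs, which keeps every quantifier bounded.\<close>
  let ?P = "\<^bold>\<exists>S. S \<^bold>\<in> 1 \<^bold>\<and> (\<^bold>\<exists>c. c \<^bold>\<in> S \<^bold>\<and> (\<^bold>\<exists>v. v \<^bold>\<in> c \<^bold>\<and> (\<^bold>\<exists>I. I \<^bold>\<in> c \<^bold>\<and> OPair0 S v I \<^bold>\<and>
    (\<^bold>\<exists>q. q \<^bold>\<in> v \<^bold>\<and> (\<^bold>\<exists>M. M \<^bold>\<in> q \<^bold>\<and> (\<^bold>\<exists>U. U \<^bold>\<in> q \<^bold>\<and> OPair0 v M U \<^bold>\<and>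
    (\<^bold>\<exists>t. t \<^bold>\<in> U \<^bold>\<and> (\<^bold>\<exists>x. x \<^bold>\<in> 0 \<^bold>\<and> OPair0 t x (Suc (Suc 0))))))))))"
  have "delta0 (?P (Suc (Suc (Suc 0))))" by (intro delta0_levels delta0_OPair0) auto
  from separation_delta0[of ?P, OF this, of ?W "Z \<rhd> a \<rhd> (\<lambda>_. a)"]
  obtain b where b: "\<And>y. y \<epsilon> b \<longleftrightarrow> y \<epsilon> ?W \<and> tr (y \<rhd> Z \<rhd> a \<rhd> (\<lambda>_. a)) (Suc (Suc (Suc 0))) ?P" by blast
  have "y \<epsilon> b \<longleftrightarrow> (\<exists>x. x \<epsilon> a \<and> F x y)" for y
  proof
    assume "y \<epsilon> b"
    then obtain M U I x where "pr (pr M U) I \<epsilon> Z" "pr x y \<epsilon> U" using b by auto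
    then show "\<exists>x. x \<epsilon> a \<and> F x y" by (auto simp: Z coding_def)
  next
    assume "\<exists>x. x \<epsilon> a \<and> F x y"
    then obtain x where x: "x \<epsilon> a" "F x y" by blast
    let ?M = "cross a (sing y)" and ?U = "sing (pr x y)"
    let ?v = "pr ?M ?U"
    have S: "coding a x y \<epsilon> Z" using x Z by blast
    have mem: "up ?v (graph a y) \<epsilon> coding a x y" "?v \<epsilon> up ?v (graph a y)" "up ?M ?U \<epsilon> ?v"
        "?U \<epsilon> up ?M ?U" "pr x y \<epsilon> ?U" "up x y \<epsilon> pr x y" "y \<epsilon> up x y"
      by (auto simp: coding_def pr_def)
    have "y \<epsilon> ?W" unfolding mem_un using S mem by blast
    moreover have "tr (y \<rhd> Z \<rhd> a \<rhd> (\<lambda>_. a)) (Suc (Suc (Suc 0))) ?P"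
      using S mem x(1)
      by (simp, rule_tac exI[of _ "coding a x y"], simp, rule_tac exI[of _ "up ?v (graph a y)"], simp,
          rule_tac exI[of _ ?v], simp, rule_tac exI[of _ "graph a y"], simp add: coding_def,
          rule_tac exI[of _ "up ?M ?U"], simp)
    ultimately show "y \<epsilon> b" using b by blast
  qed
  then show ?thesis by blast
qed

end

section \<open>Replacement\<close>

text \<open>Quantifiers are unbounded here: the formula enters only the class given to VP, and VP
  accepts arbitrary formulas.\<close>

definition Coding :: "nat \<Rightarrow> nat \<Rightarrow> nat \<Rightarrow> nat \<Rightarrow> frm" where
  "Coding a x y S = (\<^bold>\<exists>M. \<^bold>\<exists>U. \<^bold>\<exists>I. \<^bold>\<exists>v. \<^bold>\<exists>t. \<^bold>\<exists>Y. OPair S v I \<^bold>\<and> OPair v M U \<^bold>\<and>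
     UPair Y y y \<^bold>\<and> Product M a Y \<^bold>\<and> OPair t x y \<^bold>\<and> UPair U t t \<^bold>\<and>
     (\<^bold>\<forall>w. w \<^bold>\<in> I \<^bold>\<longleftrightarrow> (\<^bold>\<exists>b. b \<^bold>\<in> a \<^bold>\<and> (\<^bold>\<exists>q. OPair q b y \<^bold>\<and> OPair w b q))))"

locale vopenka_model = set_model +
  assumes VP: "p \<in> VP \<Longrightarrow> sat (=) E e p"
begin

lemma tr_Coding [simp]:
  assumes "a < d" "x < d" "y < d" "S < d"
  shows "tr e d (Coding a x y S) \<longleftrightarrow> val e d S = coding (val e d a) (val e d x) (val e d y)"
proof -
  have "tr e d (Coding a x y S) \<longleftrightarrow> (\<exists>M U I v t Y. val e d S = pr v I \<and> v = pr M U \<and>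
     Y = sing (val e d y) \<and> M = cross (val e d a) Y \<and> t = pr (val e d x) (val e d y) \<and> U = sing t \<and>
     I = graph (val e d a) (val e d y))"
    using assms by (simp add: Coding_def less_SucI eq_graph)
  then show ?thesis by (simp add: coding_def)
qed

text \<open>VP for the language with \<open>U\<close> and without \<open>R\<close>. From the
  embedding only the agreement on the sentences stating \<open>U\<close> of a constant is
  kept.\<close>

lemma vopenka_U:
  assumes "\<And>z. \<exists>y. sat (=) E (y \<rhd> e) p \<and> \<not> y \<epsilon> z \<or> \<not> sat (=) E (y \<rhd> e) p \<and> y \<epsilon> z"
    and "\<And>S. sat (=) E (S \<rhd> e) p \<Longrightarrow> \<exists>M U I. S = pr (pr M U) I \<and> (\<forall>z. z \<epsilon> U \<longrightarrow> z \<epsilon> M) \<and> func I A M"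
  obtains S S' where "sat (=) E (S \<rhd> e) p" "sat (=) E (S' \<rhd> e) p" "S \<noteq> S'"
    "\<And>c M U I M' U' I'. c \<epsilon> A \<Longrightarrow> S = pr (pr M U) I \<Longrightarrow> S' = pr (pr M' U') I' \<Longrightarrow>
      (\<exists>a. pr c a \<epsilon> I \<and> a \<epsilon> U) \<longleftrightarrow> (\<exists>a. pr c a \<epsilon> I' \<and> a \<epsilon> U')"
proof -
  have "vopenka True False p \<in> VP" unfolding VP_def by blast
  then have "sat (=) E e (vopenka True False p)" by (rule VP)
  then have "\<exists>S S'. sat (=) E (S \<rhd> e) p \<and> sat (=) E (S' \<rhd> e) p \<and> S \<noteq> S' \<and>
     (\<exists>f. tr (f \<rhd> S' \<rhd> S \<rhd> A \<rhd> e) (Suc (Suc (Suc (Suc 0))))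
        (Elementary_Embedding True False 0 (Suc 0) (Suc (Suc 0)) (Suc (Suc (Suc 0)))))"
    using assms by (simp add: vopenka_def sat_sentence Proper_Class_def)
  then obtain S S' f where *: "sat (=) E (S \<rhd> e) p" "sat (=) E (S' \<rhd> e) p" "S \<noteq> S'"
     "tr (f \<rhd> S' \<rhd> S \<rhd> A \<rhd> e) (Suc (Suc (Suc (Suc 0))))
        (Elementary_Embedding True False 0 (Suc 0) (Suc (Suc 0)) (Suc (Suc (Suc 0))))" by blast
  show thesis
    by (rule that[OF *(1-3)], rule tr_Elementary_EmbeddingD[OF *(4)]) simp_all
qed

theorem replacement_holds: "sat (=) E e (replacement p)"
proof -
  have "\<exists>b. \<forall>y. y \<epsilon> b \<longleftrightarrow> (\<exists>x. x \<epsilon> a \<and> sat (=) E (x \<rhd> y \<rhd> e) p)"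
    if fn: "\<forall>x y z. sat (=) E (x \<rhd> y \<rhd> e) p \<and> sat (=) E (x \<rhd> z \<rhd> e) p \<longrightarrow> y = z" for e a
  proof -
    let ?F = "\<lambda>x y. sat (=) E (x \<rhd> y \<rhd> e) p"
    \<comment> \<open>Level 0 is the parameter \<open>a\<close> and level 1 the structure, so
      \<open>S\<close> is the free variable 0 of \<open>q\<close> and the parameters of
      \<open>p\<close> follow after \<open>a\<close>.\<close>
    define q where "q = (\<^bold>\<exists>x. \<^bold>\<exists>y. x \<^bold>\<in> 0 \<^bold>\<and> app p [x, y] \<^bold>\<and> Coding 0 x y (Suc 0)) (Suc (Suc 0))"
    have q: "sat (=) E (S \<rhd> a \<rhd> e) q \<longleftrightarrow> (\<exists>x y. x \<epsilon> a \<and> ?F x y \<and> S = coding a x y)" for S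
      unfolding q_def tru_def[symmetric] by simp
    have "\<exists>Z. \<forall>S. S \<epsilon> Z \<longleftrightarrow> sat (=) E (S \<rhd> a \<rhd> e) q"
    proof (rule ccontr)
      assume no_set: "\<nexists>Z. \<forall>S. S \<epsilon> Z \<longleftrightarrow> sat (=) E (S \<rhd> a \<rhd> e) q"
      obtain S S' where S: "sat (=) E (S \<rhd> a \<rhd> e) q" "sat (=) E (S' \<rhd> a \<rhd> e) q" "S \<noteq> S'"
        "\<And>c M U I M' U' I'. c \<epsilon> a \<Longrightarrow> S = pr (pr M U) I \<Longrightarrow> S' = pr (pr M' U') I' \<Longrightarrow>
          (\<exists>a. pr c a \<epsilon> I \<and> a \<epsilon> U) \<longleftrightarrow> (\<exists>a. pr c a \<epsilon> I' \<and> a \<epsilon> U')"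
      \<comment> \<open>The set \<open>a\<close> is both a parameter of the class and the set of
        constants of the language.\<close>
      proof (rule vopenka_U[of "a \<rhd> e" q a])
        show "\<exists>S. sat (=) E (S \<rhd> a \<rhd> e) q \<and> \<not> S \<epsilon> z \<or> \<not> sat (=) E (S \<rhd> a \<rhd> e) q \<and> S \<epsilon> z" for z
          using no_set by blast
        show "\<exists>M U I. S = pr (pr M U) I \<and> (\<forall>z. z \<epsilon> U \<longrightarrow> z \<epsilon> M) \<and> func I a M"
          if cl: "sat (=) E (S \<rhd> a \<rhd> e) q" for S
        proof -
          obtain x y where "x \<epsilon> a" "S = coding a x y" using cl unfolding q by blast
          then show ?thesis
            by (intro exI[of _ "cross a (sing y)"] exI[of _ "sing (pr x y)"] exI[of _ "graph a y"])
              (simp add: coding_def coding_structure)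
        qed
      qed blast
      obtain x y where x: "x \<epsilon> a" "?F x y" "S = coding a x y" using S(1) unfolding q by blast
      obtain x' y' where x': "x' \<epsilon> a" "?F x' y'" "S' = coding a x' y'" using S(2) unfolding q by blast
      have g: "pr x u \<epsilon> graph a z \<longleftrightarrow> u = pr x z" for u z
        using eq_graph[of "graph a z" a z] x(1) by auto
      \<comment> \<open>The sentence stating \<open>U\<close> of the constant for \<open>x\<close>
        holds in \<open>S\<close>, hence in \<open>S'\<close>. There the constant denotes
        \<open>pr x y'\<close>, while \<open>U\<close> contains only
        \<open>pr x' y'\<close>.\<close>
      have "x = x'"
        using S(4)[OF x(1) x(3)[unfolded coding_def] x'(3)[unfolded coding_def]] by (auto simp: g)
      \<comment> \<open>Functionality now gives \<open>y = y'\<close>, so the two structures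
        coincide.\<close>
      then show False using x x' fn S(3) by blast
    qed
    then obtain Z where "\<And>S. S \<epsilon> Z \<longleftrightarrow> (\<exists>x y. x \<epsilon> a \<and> ?F x y \<and> S = coding a x y)" unfolding q by blast
    then show ?thesis by (rule image_from_codings)
  qed
  then show ?thesis by (simp add: replacement_def sat_sentence)
qed

end

lemma fbound_EST_VP: "\<forall>p \<in> EST \<union> VP. fbound p = 0"
  by (auto simp: EST_def VP_def Extensionality_def Empty_Set_def Pairing_def Union_Ax_def
      Cartesian_Product_def separation_def induction_def vopenka_def sentence_def fbound_ucl)

lemma EST_VP_replacement: "EST \<union> VP \<turnstile> replacement p"
proof (rule completeness[OF fbound_EST_VP])
  show "fbound (replacement p) = 0" by (simp add: replacement_def sentence_def fbound_ucl)
  show "\<nexists>F. finite F \<and> (\<forall>a. \<exists>b\<in>F. Q a b)"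
    if "congruence Q E" "\<forall>p\<in>EST \<union> VP. \<forall>e. sat Q E e p" for Q E :: "nat \<Rightarrow> nat \<Rightarrow> bool"
    using that by (intro no_finite_model) auto
  show "sat (=) E e (replacement p)" if "\<forall>p\<in>EST \<union> VP. \<forall>e. sat (=) E e p"
    for E :: "nat \<Rightarrow> nat \<Rightarrow> bool" and e
  proof -
    interpret vopenka_model E by unfold_locales (use that in auto)
    show ?thesis by (rule replacement_holds)
  qed
qed

theorem theorem2p13:
  "(\<forall>\<sigma> \<in> Delta0_Replacement. EST \<union> VP \<turnstile> \<sigma>) \<and>
   (\<forall>\<sigma> \<in> Replacement. EST \<union> VP \<union> Delta0_Replacement \<turnstile> \<sigma>) \<and>
   (\<forall>\<sigma> \<in> Replacement. EST \<union> VP \<turnstile> \<sigma>)"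
  unfolding Delta0_Replacement_def Replacement_def
  by (auto intro: EST_VP_replacement weaken[OF EST_VP_replacement])

end
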